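(* Suppose that $\Omega\subset\mathbb{C}^d$ is an unbounded hyperbolic domain that satisfies the visibility property with respect to $(1,\kappa)$-almost-geodesics for some $\kappa>0$ (that is, every pair of distinct points of $\partial\overline{\Omega}^{End}$ satisfies the $(1,\kappa)$-visibility property). Then the topological space $\overline{\Omega}^{End}$ is sequentially compact.
   Context: For a domain $\Omega\subset\mathbb{C}^d$, $\mathsf{k}_\Omega$ is the Kobayashi (pseudo)distance and $\kappa_\Omega(z;v)$ the Kobayashi--Royden (pseudo)metric; $\Omega$ is hyperbolic if $\mathsf{k}_\Omega$ is a distance. Almost-geodesics: for $\lambda\ge1,\kappa\ge0$ and an interval $I\subset\mathbb{R}$, a map $\sigma:I\to\Omega$ is a $(\lambda,\kappa)$-almost-geodesic (for $\mathsf{k}_\Omega$) if (i) $\frac1\lambda|s-t|-\kappa\le \mathsf{k}_\Omega(\sigma(s),\sigma(t))\le\lambda|s-t|+\kappa$ for all $s,t\in I$; (ii) $\sigma$ is absolutely continuous and $\kappa_\Omega(\sigma(t);\sigma'(t))\le\lambda$ for a.e. $t\in I$. End compactification of an unbounded domain: fix an exhaustion $(K_j)_{j\ge1}$ of $\overline\Omega$ by compact sets with $K_j$ contained in the interior (in $\overline\Omega$) of $K_{j+1}$. An end of $\overline\Omega$ is a sequence $(F_j)_{j\ge1}$ with $F_j$ a connected component of $\overline\Omega\setminus K_j$ and $F_{j+1}\subset F_j$. As a set, $\overline{\Omega}^{End}$ is $\overline\Omega$ together with all ends. Points of $\overline\Omega$ have their Euclidean neighbourhoods in $\overline\Omega$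 as neighbourhood basis; an end $(F_j)_j$ has the neighbourhood basis $(\widehat F_j)_j$, where $\widehat F_j$ is $F_j$ together with all ends $(G_\nu)_\nu$ with $G_\nu=F_\nu$ for $\nu=1,\dots,j$. (Up to natural homeomorphism this does not depend on the exhaustion.) $\partial\overline{\Omega}^{End}:=\overline{\Omega}^{End}\setminus\Omega$. Visibility of a pair: distinct $\zeta,\eta\in\partial\overline{\Omega}^{End}$ satisfy the $(\lambda,\kappa)$-visibility property if there exist neighbourhoods $V_\zeta$, $V_\eta$ of $\zeta,\eta$ in $\overline{\Omega}^{End}$ with $\overline{V_\zeta}\cap\overline{V_\eta}=\emptyset$ and a compact $K\subset\Omega$ such that every $(\lambda,\kappa)$-almost-geodesic $\sigma:[0,T]\to\Omega$ for $\mathsf{k}_\Omega$ with $\sigma(0)\in V_\zeta$, $\sigma(T)\in V_\eta$ satisfies $\sigma([0,T])\cap K\ne\emptyset$. *)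

theory Defs
  imports "HOL-Complex_Analysis.Complex_Analysis"
begin

section \<open>Kobayashi distance and Kobayashi--Royden metric\<close>

definition holomorphic_disc :: "(complex ^ 'd) set \<Rightarrow> (complex \<Rightarrow> complex ^ 'd) \<Rightarrow> bool" where
  "holomorphic_disc \<Omega> \<phi> \<longleftrightarrow>
     (\<forall>i. (\<lambda>\<zeta>. vec_nth (\<phi> \<zeta>) i) holomorphic_on ball 0 1) \<and> \<phi> ` ball 0 1 \<subseteq> \<Omega>"

text \<open>Normalised so that the infinitesimal metric at 0 is the Euclidean one, which is the
  normalisation matching \<open>kobayashi_metric\<close> below.\<close>

definition poincare_dist :: "complex \<Rightarrow> complex \<Rightarrow> real" where
  "poincare_dist a b = artanh (cmod ((a - b) / (1 - cnj a * b)))"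

text \<open>The infimum is over chains of holomorphic discs from \<open>z\<close> to \<open>w\<close>. For \<open>z\<close>, \<open>w\<close> in a domain
  such chains exist, so this is an infimum of a nonempty set bounded below by 0; for arguments
  outside \<open>\<Omega>\<close> the value is meaningless.\<close>

definition kobayashi_dist :: "(complex ^ 'd) set \<Rightarrow> complex ^ 'd \<Rightarrow> complex ^ 'd \<Rightarrow> real" where
  "kobayashi_dist \<Omega> z w =
     Inf {(\<Sum>i<n. poincare_dist (a i) (b i)) | (n :: nat) a b \<phi> x.
            (\<forall>i<n. holomorphic_disc \<Omega> (\<phi> i) \<and> a i \<in> ball 0 1 \<and> b i \<in> ball 0 1 \<and>
                   \<phi> i (a i) = x i \<and> \<phi> i (b i) = x (Suc i)) \<and>
            x 0 = z \<and> x n = w}"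

definition kobayashi_metric :: "(complex ^ 'd) set \<Rightarrow> complex ^ 'd \<Rightarrow> complex ^ 'd \<Rightarrow> real" where
  "kobayashi_metric \<Omega> z v =
     Inf {cmod \<xi> | \<xi> \<phi>. holomorphic_disc \<Omega> \<phi> \<and> \<phi> 0 = z \<and>
            \<xi> *s (\<chi> i. deriv (\<lambda>\<zeta>. vec_nth (\<phi> \<zeta>) i) 0) = v}"

text \<open>On a domain \<open>kobayashi_dist\<close> is always a pseudodistance, so being a distance amounts to
  separating points.\<close>

definition kobayashi_hyperbolic :: "(complex ^ 'd) set \<Rightarrow> bool" where
  "kobayashi_hyperbolic \<Omega> \<longleftrightarrow>
     (\<forall>z\<in>\<Omega>. \<forall>w\<in>\<Omega>. kobayashi_dist \<Omega> z w = 0 \<longrightarrow> z = w)"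


section \<open>Almost-geodesics\<close>

definition absolutely_continuous_curve_on ::
    "real set \<Rightarrow> (real \<Rightarrow> 'a::real_normed_vector) \<Rightarrow> bool" where
  "absolutely_continuous_curve_on I \<sigma> \<longleftrightarrow>
     (\<forall>\<epsilon>>0. \<exists>\<delta>>0. \<forall>(n::nat) s t.
        (\<forall>i<n. s i \<in> I \<and> t i \<in> I \<and> s i \<le> t i) \<and>
        (\<forall>i<n. \<forall>j<n. i \<noteq> j \<longrightarrow> {s i<..<t i} \<inter> {s j<..<t j} = {}) \<and>
        (\<Sum>i<n. t i - s i) < \<delta> \<longrightarrow>
        (\<Sum>i<n. norm (\<sigma> (t i) - \<sigma> (s i))) < \<epsilon>)"

definition almost_geodesic ::
    "(complex ^ 'd) set \<Rightarrow> real \<Rightarrow> real \<Rightarrow> real set \<Rightarrow> (real \<Rightarrow> complex ^ 'd) \<Rightarrow> bool" where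
  "almost_geodesic \<Omega> L \<kappa> I \<sigma> \<longleftrightarrow>
     is_interval I \<and> \<sigma> ` I \<subseteq> \<Omega> \<and>
     (\<forall>s\<in>I. \<forall>t\<in>I. (1 / L) * \<bar>s - t\<bar> - \<kappa> \<le> kobayashi_dist \<Omega> (\<sigma> s) (\<sigma> t) \<and>
                   kobayashi_dist \<Omega> (\<sigma> s) (\<sigma> t) \<le> L * \<bar>s - t\<bar> + \<kappa>) \<and>
     absolutely_continuous_curve_on I \<sigma> \<and>
     (AE t in lebesgue. t \<in> I \<longrightarrow>
        (\<exists>v. (\<sigma> has_vector_derivative v) (at t within I) \<and> kobayashi_metric \<Omega> (\<sigma> t) v \<le> L))"


section \<open>End compactification\<close>

text \<open>Exhaustions are indexed from 0 rather than from 1.\<close>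

definition compact_exhaustion :: "'a::topological_space set \<Rightarrow> (nat \<Rightarrow> 'a set) \<Rightarrow> bool" where
  "compact_exhaustion X K \<longleftrightarrow>
     (\<forall>j. compact (K j) \<and> K j \<subseteq> (top_of_set X) interior_of (K (Suc j)) \<and> K j \<subseteq> X) \<and>
     (\<Union>j. K j) = X"

definition ends :: "'a::topological_space set \<Rightarrow> (nat \<Rightarrow> 'a set) \<Rightarrow> (nat \<Rightarrow> 'a set) set" where
  "ends X K = {F. \<forall>j. F j \<in> components (X - K j) \<and> F (Suc j) \<subseteq> F j}"

datatype 'a end_point = Pt 'a | End "nat \<Rightarrow> 'a set"

definition end_nbhd ::
    "'a::topological_space set \<Rightarrow> (nat \<Rightarrow> 'a set) \<Rightarrow> (nat \<Rightarrow> 'a set) \<Rightarrow> nat \<Rightarrow> 'a end_point set" where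
  "end_nbhd X K F j = Pt ` F j \<union> End ` {G \<in> ends X K. \<forall>\<nu>\<le>j. G \<nu> = F \<nu>}"

text \<open>A set is open iff it contains a basic neighbourhood of each of its points. If \<open>X\<close> is not
  locally connected, components of \<open>X - K j\<close> need not be relatively open, so \<open>end_nbhd X K F j\<close>
  itself is not asserted to be open.\<close>

definition open_in_ends ::
    "'a::topological_space set \<Rightarrow> (nat \<Rightarrow> 'a set) \<Rightarrow> 'a end_point set \<Rightarrow> bool" where
  "open_in_ends X K U \<longleftrightarrow>
     U \<subseteq> Pt ` X \<union> End ` ends X K \<and>
     (\<forall>x. Pt x \<in> U \<longrightarrow> (\<exists>V. openin (top_of_set X) V \<and> x \<in> V \<and> Pt ` V \<subseteq> U)) \<and>
     (\<forall>F. End F \<in> U \<longrightarrow> (\<exists>j. end_nbhd X K F j \<subseteq> U))"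

definition end_compactification ::
    "'a::topological_space set \<Rightarrow> (nat \<Rightarrow> 'a set) \<Rightarrow> 'a end_point topology" where
  "end_compactification X K = topology (open_in_ends X K)"

lemma end_nbhd_antimono:
  assumes "F \<in> ends X K" "i \<le> j"
  shows "end_nbhd X K F j \<subseteq> end_nbhd X K F i"
proof -
  have "F (Suc n) \<subseteq> F n" for n
    using assms(1) unfolding ends_def by blast
  then have "F j \<subseteq> F i"
    using lift_Suc_antimono_le[of F i j] assms(2) by blast
  moreover have "\<forall>\<nu>\<le>i. G \<nu> = F \<nu>" if "\<forall>\<nu>\<le>j. G \<nu> = F \<nu>" for G :: "nat \<Rightarrow> 'a set"
    using that assms(2) order_trans by blast
  ultimately show ?thesis
    unfolding end_nbhd_def by blast
qed

lemma open_in_endsD: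
  assumes "open_in_ends X K U"
  shows "U \<subseteq> Pt ` X \<union> End ` ends X K"
    and "Pt x \<in> U \<Longrightarrow> \<exists>V. openin (top_of_set X) V \<and> x \<in> V \<and> Pt ` V \<subseteq> U"
    and "End F \<in> U \<Longrightarrow> F \<in> ends X K \<and> (\<exists>j. end_nbhd X K F j \<subseteq> U)"
proof -
  show sub: "U \<subseteq> Pt ` X \<union> End ` ends X K"
    using assms unfolding open_in_ends_def by (elim conjE)
  show "\<exists>V. openin (top_of_set X) V \<and> x \<in> V \<and> Pt ` V \<subseteq> U" if "Pt x \<in> U"
    using assms that unfolding open_in_ends_def by (elim conjE allE[where x = x]) (erule mp)
  show "F \<in> ends X K \<and> (\<exists>j. end_nbhd X K F j \<subseteq> U)" if F: "End F \<in> U"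
  proof
    show "F \<in> ends X K"
      using subsetD[OF sub F] by auto
    show "\<exists>j. end_nbhd X K F j \<subseteq> U"
      using assms F unfolding open_in_ends_def by (elim conjE allE[where x = F]) (erule mp)
  qed
qed

lemma istopology_open_in_ends: "istopology (open_in_ends X K)"
  unfolding istopology_def
proof (intro conjI allI impI)
  fix S T assume S: "open_in_ends X K S" and T: "open_in_ends X K T"
  show "open_in_ends X K (S \<inter> T)"
    unfolding open_in_ends_def
  proof (intro conjI allI impI)
    show "S \<inter> T \<subseteq> Pt ` X \<union> End ` ends X K"
      using open_in_endsD(1)[OF S] by (rule le_infI1)
  next
    fix x assume x: "Pt x \<in> S \<inter> T"
    obtain V where V: "openin (top_of_set X) V" "x \<in> V" "Pt ` V \<subseteq> S"
      using open_in_endsD(2)[OF S IntD1[OF x]] by (elim exE conjE)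
    obtain W where W: "openin (top_of_set X) W" "x \<in> W" "Pt ` W \<subseteq> T"
      using open_in_endsD(2)[OF T IntD2[OF x]] by (elim exE conjE)
    have "openin (top_of_set X) (V \<inter> W)" "x \<in> V \<inter> W" "Pt ` (V \<inter> W) \<subseteq> S \<inter> T"
      using V W by blast+
    then show "\<exists>V. openin (top_of_set X) V \<and> x \<in> V \<and> Pt ` V \<subseteq> S \<inter> T"
      by (intro exI[of _ "V \<inter> W"] conjI)
  next
    fix F assume F: "End F \<in> S \<inter> T"
    have e: "F \<in> ends X K"
      using open_in_endsD(3)[OF S IntD1[OF F]] by (elim conjE)
    obtain i where i: "end_nbhd X K F i \<subseteq> S"
      using open_in_endsD(3)[OF S IntD1[OF F]] by (elim exE conjE)
    obtain j where j: "end_nbhd X K F j \<subseteq> T"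
      using open_in_endsD(3)[OF T IntD2[OF F]] by (elim exE conjE)
    have "end_nbhd X K F (max i j) \<subseteq> S \<inter> T"
      using order_trans[OF end_nbhd_antimono[OF e max.cobounded1] i]
        order_trans[OF end_nbhd_antimono[OF e max.cobounded2] j]
      by (rule Int_greatest)
    then show "\<exists>j. end_nbhd X K F j \<subseteq> S \<inter> T" by (rule exI)
  qed
next
  fix \<U> assume U: "\<forall>U\<in>\<U>. open_in_ends X K U"
  show "open_in_ends X K (\<Union>\<U>)"
    unfolding open_in_ends_def
  proof (intro conjI allI impI)
    show "\<Union>\<U> \<subseteq> Pt ` X \<union> End ` ends X K"
      using U by (intro Union_least open_in_endsD(1)) (rule bspec)
  next
    fix x assume "Pt x \<in> \<Union>\<U>"
    then obtain U where x: "U \<in> \<U>" "Pt x \<in> U" by (rule UnionE)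
    obtain V where "openin (top_of_set X) V" "x \<in> V" "Pt ` V \<subseteq> U"
      using open_in_endsD(2)[OF bspec[OF U x(1)] x(2)] by (elim exE conjE)
    then show "\<exists>V. openin (top_of_set X) V \<and> x \<in> V \<and> Pt ` V \<subseteq> \<Union>\<U>"
      using x(1) by (intro exI[of _ V] conjI) (assumption, assumption, rule order_trans[OF _ Union_upper])
  next
    fix F assume "End F \<in> \<Union>\<U>"
    then obtain U where F: "U \<in> \<U>" "End F \<in> U" by (rule UnionE)
    obtain j where "end_nbhd X K F j \<subseteq> U"
      using open_in_endsD(3)[OF bspec[OF U F(1)] F(2)] by (elim exE conjE)
    then show "\<exists>j. end_nbhd X K F j \<subseteq> \<Union>\<U>"
      using F(1) by (intro exI[of _ j]) (rule order_trans[OF _ Union_upper])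
  qed
qed

lemma openin_end_compactification:
  "openin (end_compactification X K) U \<longleftrightarrow> open_in_ends X K U"
  unfolding end_compactification_def topology_inverse'[OF istopology_open_in_ends] ..

lemma topspace_end_compactification:
  "topspace (end_compactification X K) = Pt ` X \<union> End ` ends X K"
proof (rule antisym)
  have "open_in_ends X K (topspace (end_compactification X K))"
    unfolding openin_end_compactification[symmetric] by (rule openin_topspace)
  then show "topspace (end_compactification X K) \<subseteq> Pt ` X \<union> End ` ends X K"
    by (rule open_in_endsD(1))
next
  have "open_in_ends X K (Pt ` X \<union> End ` ends X K)"
    unfolding open_in_ends_def
  proof (intro conjI allI impI)
    show "Pt ` X \<union> End ` ends X K \<subseteq> Pt ` X \<union> End ` ends X K" ..
  next
    fix x assume "Pt x \<in> Pt ` X \<union> End ` ends X K"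
    then have "x \<in> X" by auto
    then show "\<exists>V. openin (top_of_set X) V \<and> x \<in> V \<and> Pt ` V \<subseteq> Pt ` X \<union> End ` ends X K"
      by (intro exI[of _ X] conjI openin_subtopology_self Un_upper1)
  next
    fix F assume "End F \<in> Pt ` X \<union> End ` ends X K"
    then have "F 0 \<in> components (X - K 0)" by (auto simp: ends_def)
    then have "F 0 \<subseteq> X" by (blast dest: in_components_subset)
    then have "end_nbhd X K F 0 \<subseteq> Pt ` X \<union> End ` ends X K"
      unfolding end_nbhd_def by blast
    then show "\<exists>j. end_nbhd X K F j \<subseteq> Pt ` X \<union> End ` ends X K" by (rule exI)
  qed
  then show "Pt ` X \<union> End ` ends X K \<subseteq> topspace (end_compactification X K)"
    unfolding openin_end_compactification[symmetric] by (rule openin_subset)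
qed

definition end_boundary ::
    "'a::topological_space set \<Rightarrow> (nat \<Rightarrow> 'a set) \<Rightarrow> 'a end_point set" where
  "end_boundary \<Omega> K = topspace (end_compactification (closure \<Omega>) K) - Pt ` \<Omega>"


section \<open>Visibility\<close>

definition visible_pair ::
    "(complex ^ 'd) set \<Rightarrow> (nat \<Rightarrow> (complex ^ 'd) set) \<Rightarrow> real \<Rightarrow> real \<Rightarrow>
     (complex ^ 'd) end_point \<Rightarrow> (complex ^ 'd) end_point \<Rightarrow> bool" where
  "visible_pair \<Omega> K L \<kappa> \<zeta> \<eta> \<longleftrightarrow>
     (let E = end_compactification (closure \<Omega>) K in
      \<exists>V W C. V \<subseteq> topspace E \<and> \<zeta> \<in> E interior_of V \<and>
              W \<subseteq> topspace E \<and> \<eta> \<in> E interior_of W \<and>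
              E closure_of V \<inter> E closure_of W = {} \<and>
              compact C \<and> C \<subseteq> \<Omega> \<and>
              (\<forall>T\<ge>0. \<forall>\<sigma>. almost_geodesic \<Omega> L \<kappa> {0..T} \<sigma> \<and> Pt (\<sigma> 0) \<in> V \<and> Pt (\<sigma> T) \<in> W \<longrightarrow>
                 \<sigma> ` {0..T} \<inter> C \<noteq> {}))"

definition visibility_property ::
    "(complex ^ 'd) set \<Rightarrow> (nat \<Rightarrow> (complex ^ 'd) set) \<Rightarrow> real \<Rightarrow> real \<Rightarrow> bool" where
  "visibility_property \<Omega> K L \<kappa> \<longleftrightarrow>
     (\<forall>\<zeta>\<in>end_boundary \<Omega> K. \<forall>\<eta>\<in>end_boundary \<Omega> K. \<zeta> \<noteq> \<eta> \<longrightarrow> visible_pair \<Omega> K L \<kappa> \<zeta> \<eta>)"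


section \<open>Sequential compactness\<close>

definition sequentially_compact_space :: "'a topology \<Rightarrow> bool" where
  "sequentially_compact_space X \<longleftrightarrow>
     (\<forall>f :: nat \<Rightarrow> 'a. range f \<subseteq> topspace X \<longrightarrow>
        (\<exists>l r. l \<in> topspace X \<and> strict_mono (r :: nat \<Rightarrow> nat) \<and>
               limitin X (f \<circ> r) l sequentially))"

end

theory Submission
  imports Defs "HOL-Library.Diagonal_Subsequence"
begin

text \<open>A chain of holomorphic discs whose length is within \<open>\<kappa>\<close> of the Kobayashi distance, traversed along
  the Poincare geodesics \<open>t \<mapsto> tanh t\<close> of its discs, is a \<open>(1, \<kappa>)\<close>-almost-geodesic, so any two points of
  \<open>\<Omega>\<close> are joined by one. If infinitely many components of \<open>\<Omega> - K j\<close> reached beyond \<open>K (j + 2)\<close>,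
  almost-geodesics joining points far out in different components would cross the shell between
  \<open>K (j + 1)\<close> and \<open>K (j + 2)\<close> inside pairwise distinct components. The end points of these crossings
  accumulate at two distinct points of the boundary of \<open>\<Omega>\<close>; by visibility the crossings also accumulate
  at a point of \<open>\<Omega> - K j\<close>, around which there is only one component, a contradiction. Hence only
  finitely many components of \<open>closure \<Omega> - K j\<close> reach far out, and a diagonal argument produces an end
  to which a subsequence of any sequence leaving all the \<open>K j\<close> converges.\<close>

no_notation fps_nth (infixl "$" 75)

section \<open>Chains of holomorphic discs\<close>

text \<open>The chains in the definition of \<open>kobayashi_dist\<close>, recast inductively so
  that joining, reversing and parametrising them become inductions on the discs. The empty chain
  \<open>refl\<close> is allowed at every point, even outside \<open>\<Omega>\<close>.\<close>

inductive disc_chain :: "(complex ^ 'd) set \<Rightarrow> complex ^ 'd \<Rightarrow> complex ^ 'd \<Rightarrow> real \<Rightarrow> bool"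
  for \<Omega> where
  refl: "disc_chain \<Omega> z z 0"
| step: "\<lbrakk>holomorphic_disc \<Omega> \<phi>; cmod a < 1; cmod b < 1; disc_chain \<Omega> (\<phi> b) w L\<rbrakk>
    \<Longrightarrow> disc_chain \<Omega> (\<phi> a) w (poincare_dist a b + L)"

section \<open>The Poincare distance on the unit disc\<close>

lemma poincare_dist_Moebius: "poincare_dist a b = artanh (cmod (Moebius_function 0 a b))"
  by (simp add: poincare_dist_def Moebius_function_simple norm_divide norm_minus_commute)

lemma poincare_dist_commute: "poincare_dist a b = poincare_dist b a"
proof -
  have "1 - cnj a * b = cnj (1 - cnj b * a)"
    by simp
  then have "cmod (1 - cnj a * b) = cmod (1 - cnj b * a)"
    by (metis complex_mod_cnj)
  then show ?thesis
    by (simp add: poincare_dist_def norm_divide norm_minus_commute)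
qed

lemma artanh_nonneg_real: "0 \<le> x \<Longrightarrow> x < 1 \<Longrightarrow> 0 \<le> artanh (x::real)"
  by (auto simp: artanh_def field_simps)

lemma tanh_artanh_real:
  assumes "\<bar>x::real\<bar> < 1" shows "tanh (artanh x) = x"
proof -
  have "- 2 * artanh x = ln ((1 - x) / (1 + x))"
    using assms by (simp add: artanh_def ln_div)
  then have e: "exp (- 2 * artanh x) = (1 - x) / (1 + x)"
    using assms by simp
  show ?thesis
    unfolding tanh_real_altdef e using assms by (simp add: field_simps)
qed

lemma poincare_dist_nonneg:
  assumes "cmod a < 1" "cmod b < 1" shows "0 \<le> poincare_dist a b"
  unfolding poincare_dist_Moebius
  by (rule artanh_nonneg_real) (use assms Moebius_function_norm_lt_1 in auto)

text \<open>By the addition formula, the Moebius quotient of \<open>tanh s\<close> and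
  \<open>tanh t\<close> is \<open>tanh (t - s)\<close>. Thus \<open>tanh\<close> runs along the real
  diameter at unit Poincare speed.\<close>

lemma poincare_dist_tanh:
  assumes "s \<le> t"
  shows "poincare_dist (of_real (tanh s)) (of_real (tanh t)) = t - s"
proof -
  have "(tanh t - tanh s) / (1 - tanh s * tanh t) = tanh (t - s)"
    using tanh_add[of t "- s"] by (simp add: mult.commute)
  moreover have "Moebius_function 0 (of_real (tanh s)) (of_real (tanh t)) =
      of_real ((tanh t - tanh s) / (1 - tanh s * tanh t))"
    by (simp add: Moebius_function_simple)
  ultimately have "Moebius_function 0 (of_real (tanh s)) (of_real (tanh t)) = of_real (tanh (t - s))"
    by simp
  moreover have "\<bar>tanh (t - s)\<bar> = tanh (t - s)"
    using assms by simp
  ultimately show ?thesis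
    by (simp only: poincare_dist_Moebius norm_of_real artanh_tanh_real)
qed

lemma disc_chain_nonneg: "disc_chain \<Omega> z w L \<Longrightarrow> 0 \<le> L"
  by (induction rule: disc_chain.induct) (auto simp: poincare_dist_nonneg)

lemma disc_chain_trans:
  "disc_chain \<Omega> z w L \<Longrightarrow> disc_chain \<Omega> w u M \<Longrightarrow> disc_chain \<Omega> z u (L + M)"
  by (induction rule: disc_chain.induct) (auto simp: add.assoc intro: disc_chain.step)

lemma disc_chain_single:
  assumes "holomorphic_disc \<Omega> \<phi>" "cmod a < 1" "cmod b < 1"
  shows "disc_chain \<Omega> (\<phi> a) (\<phi> b) (poincare_dist a b)"
  using disc_chain.step[OF assms disc_chain.refl] by simp

lemma disc_chain_sym: "disc_chain \<Omega> z w L \<Longrightarrow> disc_chain \<Omega> w z L"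
proof (induction rule: disc_chain.induct)
  case (step \<phi> a b w L)
  then have "disc_chain \<Omega> (\<phi> b) (\<phi> a) (poincare_dist b a)"
    by (intro disc_chain_single)
  then have "disc_chain \<Omega> w (\<phi> a) (L + poincare_dist b a)"
    by (rule disc_chain_trans[OF step.IH])
  then show ?case
    by (simp add: add.commute poincare_dist_commute)
qed (rule disc_chain.refl)

lemma disc_chain_of_sequence:
  assumes "\<forall>i<n. holomorphic_disc \<Omega> (\<phi> i) \<and> a i \<in> ball 0 1 \<and> b i \<in> ball 0 1 \<and>
    \<phi> i (a i) = x i \<and> \<phi> i (b i) = x (Suc i)"
  shows "disc_chain \<Omega> (x 0) (x n) (\<Sum>i<n. poincare_dist (a i) (b i))"
  using assms
proof (induction n)
  case (Suc n)
  then have "disc_chain \<Omega> (\<phi> n (a n)) (\<phi> n (b n)) (poincare_dist (a n) (b n))"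
    by (intro disc_chain_single) auto
  then have "disc_chain \<Omega> (x n) (x (Suc n)) (poincare_dist (a n) (b n))"
    using Suc.prems by simp
  moreover have "disc_chain \<Omega> (x 0) (x n) (\<Sum>i<n. poincare_dist (a i) (b i))"
    using Suc.prems by (intro Suc.IH) simp
  ultimately show ?case
    unfolding sum.lessThan_Suc by (intro disc_chain_trans)
qed (simp add: disc_chain.refl)

lemma sequence_of_disc_chain:
  assumes "disc_chain \<Omega> z w L"
  shows "\<exists>n a b \<phi> x. L = (\<Sum>i<n. poincare_dist (a i) (b i)) \<and>
    (\<forall>i<n. holomorphic_disc \<Omega> (\<phi> i) \<and> a i \<in> ball 0 1 \<and> b i \<in> ball 0 1 \<and>
      \<phi> i (a i) = x i \<and> \<phi> i (b i) = x (Suc i)) \<and> x (0::nat) = z \<and> x n = w"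
  using assms
proof (induction rule: disc_chain.induct)
  case (refl z)
  show ?case
    by (rule exI[of _ 0]) auto
next
  case (step \<psi> p q w L)
  then obtain n a b \<phi> x where *: "L = (\<Sum>i<n. poincare_dist (a i) (b i))"
    "\<forall>i<n. holomorphic_disc \<Omega> (\<phi> i) \<and> a i \<in> ball 0 1 \<and> b i \<in> ball 0 1 \<and>
      \<phi> i (a i) = x i \<and> \<phi> i (b i) = x (Suc i)" "x (0::nat) = \<psi> q" "x n = w"
    by blast
  \<comment> \<open>\<open>case_nat\<close> inserts the data of the new first disc at index 0 and
    shifts the old chain by one.\<close>
  let ?a = "case_nat p a" and ?b = "case_nat q b" and ?\<phi> = "case_nat \<psi> \<phi>"
    and ?x = "case_nat (\<psi> p) x"
  have "poincare_dist p q + L = (\<Sum>i<Suc n. poincare_dist (?a i) (?b i))"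
    unfolding sum.lessThan_Suc_shift *(1) by simp
  moreover have "holomorphic_disc \<Omega> (?\<phi> i) \<and> ?a i \<in> ball 0 1 \<and> ?b i \<in> ball 0 1 \<and>
      ?\<phi> i (?a i) = ?x i \<and> ?\<phi> i (?b i) = ?x (Suc i)" if "i < Suc n" for i
    using that *(2,3) step.hyps by (cases i) simp_all
  moreover have "?x 0 = \<psi> p" "?x (Suc n) = w"
    using * by simp_all
  ultimately show ?case
    by blast
qed

section \<open>The Kobayashi distance as an infimum over chains\<close>

lemma kobayashi_dist_disc_chain: "kobayashi_dist \<Omega> z w = Inf {L. disc_chain \<Omega> z w L}"
  unfolding kobayashi_dist_def
proof (rule arg_cong[where f = Inf], intro set_eqI iffI; unfold mem_Collect_eq)
  fix L assume "disc_chain \<Omega> z w L"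
  from sequence_of_disc_chain[OF this] show "\<exists>n a b \<phi> x. L = (\<Sum>i<n. poincare_dist (a i) (b i)) \<and>
    (\<forall>i<n. holomorphic_disc \<Omega> (\<phi> i) \<and> a i \<in> ball 0 1 \<and> b i \<in> ball 0 1 \<and>
      \<phi> i (a i) = x i \<and> \<phi> i (b i) = x (Suc i)) \<and> x (0::nat) = z \<and> x n = w" .
qed (elim exE conjE, hypsubst, rule disc_chain_of_sequence)

lemma kobayashi_dist_le:
  assumes "disc_chain \<Omega> z w L" shows "kobayashi_dist \<Omega> z w \<le> L"
  unfolding kobayashi_dist_disc_chain
  by (rule cInf_lower) (use assms disc_chain_nonneg in \<open>auto intro!: bdd_belowI[of _ 0]\<close>)

text \<open>The chain of length \<open>M\<close> guarantees that the infimum is taken over a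
  nonempty set, so that it is approached by actual chains.\<close>

lemma disc_chain_near_optimal:
  assumes "disc_chain \<Omega> z w M" "\<epsilon> > 0"
  obtains L where "disc_chain \<Omega> z w L" "L < kobayashi_dist \<Omega> z w + \<epsilon>"
proof -
  have "\<exists>L\<in>{L. disc_chain \<Omega> z w L}. L < kobayashi_dist \<Omega> z w + \<epsilon>"
    by (rule cInf_lessD) (use assms in \<open>auto simp: kobayashi_dist_disc_chain\<close>)
  with that show thesis by blast
qed

lemma holomorphic_disc_affine:
  assumes "ball z r \<subseteq> \<Omega>" "norm v < r"
  shows "holomorphic_disc \<Omega> (\<lambda>\<zeta>. z + \<zeta> *s v)"
  unfolding holomorphic_disc_def
proof safe
  fix \<zeta> :: complex assume "\<zeta> \<in> ball 0 1"
  then have z: "cmod \<zeta> \<le> 1" by simp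
  have "norm (\<zeta> *s v) = cmod \<zeta> * norm v"
    by (simp add: norm_vec_def norm_mult L2_set_def power_mult_distrib real_sqrt_mult
        flip: sum_distrib_left)
  also have "\<dots> \<le> norm v"
    using z by (simp add: mult_left_le_one_le)
  finally show "z + \<zeta> *s v \<in> \<Omega>"
    using assms by (auto simp: dist_norm subset_iff)
qed (auto intro!: holomorphic_intros)

text \<open>Being joined by a chain is an equivalence relation, and its classes are open because
  affine discs reach all nearby points. A connected set then has a single class.\<close>

lemma disc_chain_exists:
  assumes "open \<Omega>" "connected \<Omega>" "z \<in> \<Omega>" "w \<in> \<Omega>"
  shows "\<exists>L. disc_chain \<Omega> z w L"
proof (rule connected_equivalence_relation[OF assms(2,3,4)])
  fix x assume "x \<in> \<Omega>"
  then obtain r where r: "r > 0" "ball x r \<subseteq> \<Omega>"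
    using assms(1) open_contains_ball by blast
  \<comment> \<open>The affine disc with direction \<open>2 *s (y - x)\<close> takes 0 to
    \<open>x\<close> and \<open>1/2\<close> to \<open>y\<close>; the factor 2 keeps the parameter of
    \<open>y\<close> inside the unit disc and explains the radius \<open>r / 2\<close>.\<close>
  have near: "\<exists>L. disc_chain \<Omega> x y L" if "y \<in> ball x (r / 2)" for y
  proof -
    have "2 *s (y - x) = 2 *\<^sub>R (y - x)"
      by (simp add: vec_eq_iff scaleR_conv_of_real)
    then have "norm (2 *s (y - x)) < r"
      using that by (simp add: dist_norm norm_minus_commute)
    then show ?thesis
      using disc_chain_single[OF holomorphic_disc_affine[OF r(2), of "2 *s (y - x)"], of 0 "1/2"]
      by (auto simp: vector_smult_assoc)
  qed
  show "\<exists>T. openin (top_of_set \<Omega>) T \<and> x \<in> T \<and> (\<forall>y\<in>T. \<exists>L. disc_chain \<Omega> x y L)"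
    by (intro exI[of _ "\<Omega> \<inter> ball x (r / 2)"])
      (use r near \<open>x \<in> \<Omega>\<close> in \<open>auto intro: openin_open_Int\<close>)
qed (meson disc_chain_sym disc_chain_trans)+

section \<open>Near-optimal chains as almost-geodesics\<close>

text \<open>Parametrising a curve by the length of its underlying chain of discs bounds both the Kobayashi
  distance and the Kobayashi--Royden metric along it, so that no comparison of the two is needed.\<close>

definition disc_curve :: "(complex ^ 'd) set \<Rightarrow> real \<Rightarrow> (real \<Rightarrow> complex ^ 'd) \<Rightarrow> bool" where
  "disc_curve \<Omega> T \<sigma> \<longleftrightarrow> 0 \<le> T \<and> \<sigma> ` {0..T} \<subseteq> \<Omega> \<and>
     (\<forall>s t. 0 \<le> s \<longrightarrow> s \<le> t \<longrightarrow> t \<le> T \<longrightarrow> disc_chain \<Omega> (\<sigma> s) (\<sigma> t) (t - s)) \<and>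
     (\<exists>B. B-lipschitz_on {0..T} \<sigma>) \<and>
     (\<exists>S. finite S \<and> (\<forall>t\<in>{0<..<T} - S.
        \<exists>v. (\<sigma> has_vector_derivative v) (at t) \<and> kobayashi_metric \<Omega> (\<sigma> t) v \<le> 1))"

lemma disc_curve_continuous: "disc_curve \<Omega> T \<sigma> \<Longrightarrow> continuous_on {0..T} \<sigma>"
  unfolding disc_curve_def by (auto intro: lipschitz_on_continuous_on)

lemma disc_curve_const:
  assumes "z \<in> \<Omega>" shows "disc_curve \<Omega> 0 (\<lambda>_. z)"
proof -
  have "disc_chain \<Omega> z z (t - s)" if "0 \<le> s" "s \<le> t" "t \<le> 0" for s t
  proof -
    have "t - s = 0" using that by linarith
    then show ?thesis by (simp add: disc_chain.refl)
  qed
  moreover have "\<exists>B. B-lipschitz_on {0..0::real} (\<lambda>_. z)"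
    using lipschitz_on_constant by blast
  ultimately show ?thesis
    using assms unfolding disc_curve_def by auto
qed

section \<open>Curves traced in a single disc\<close>

lemma has_vector_derivative_vec:
  fixes f :: "real \<Rightarrow> ('a::euclidean_space) ^ 'd"
  assumes "\<And>i. ((\<lambda>t. f t $ i) has_vector_derivative f' $ i) (at t within S)"
  shows "(f has_vector_derivative f') (at t within S)"
  unfolding has_vector_derivative_def
proof (subst has_derivative_componentwise_within, rule ballI)
  fix b :: "'a ^ 'd" assume "b \<in> Basis"
  then obtain i u where "b = axis i u"
    by (auto simp: Basis_vec_def)
  then show "((\<lambda>x. f x \<bullet> b) has_derivative (\<lambda>x. x *\<^sub>R f' \<bullet> b)) (at t within S)"
    using has_derivative_inner_left[OF assms[of i, unfolded has_vector_derivative_def], of u]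
    by (simp add: inner_axis)
qed

lemma C1_curve_lipschitz:
  fixes f :: "real \<Rightarrow> 'a::real_normed_vector"
  assumes f: "\<And>t. t \<in> {a..b} \<Longrightarrow> (f has_vector_derivative f' t) (at t)"
    and cont: "continuous_on {a..b} f'"
  shows "\<exists>B. B-lipschitz_on {a..b} f"
proof -
  have "bounded (f' ` {a..b})"
    using compact_continuous_image[OF cont] by (simp add: compact_imp_bounded)
  then obtain B where B: "B > 0" "\<And>t. t \<in> {a..b} \<Longrightarrow> norm (f' t) \<le> B"
    unfolding bounded_pos by auto
  have "B-lipschitz_on {a..b} f"
  proof (rule bounded_derivative_imp_lipschitz)
    fix t assume t: "t \<in> {a..b}"
    show "(f has_derivative (\<lambda>h. h *\<^sub>R f' t)) (at t within {a..b})"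
      using f[OF t] has_derivative_at_withinI unfolding has_vector_derivative_def by blast
    show "onorm (\<lambda>h. h *\<^sub>R f' t) \<le> B"
      using B(1) B(2)[OF t] by (intro onorm_bound) (auto simp: mult.commute[of B] intro!: mult_left_mono)
  qed (use B in auto)
  then show ?thesis ..
qed

text \<open>The disc itself, with multiplier 1, competes in the infimum. This is the only source of
  bounds on the metric.\<close>

lemma kobayashi_metric_le:
  assumes "holomorphic_disc \<Omega> \<phi>"
  shows "kobayashi_metric \<Omega> (\<phi> 0) (\<chi> i. deriv (\<lambda>\<zeta>. \<phi> \<zeta> $ i) 0) \<le> 1"
  unfolding kobayashi_metric_def
proof (rule cInf_lower)
  show "1 \<in> {cmod \<xi> |\<xi> \<phi>'. holomorphic_disc \<Omega> \<phi>' \<and> \<phi>' 0 = \<phi> 0 \<and>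
      \<xi> *s (\<chi> i. deriv (\<lambda>\<zeta>. \<phi>' \<zeta> $ i) 0) = (\<chi> i. deriv (\<lambda>\<zeta>. \<phi> \<zeta> $ i) 0)}"
    unfolding mem_Collect_eq by (rule exI[of _ 1], rule exI[of _ \<phi>]) (simp add: assms)
qed (auto intro!: bdd_belowI[of _ 0])

lemma holomorphic_disc_compose:
  assumes "holomorphic_disc \<Omega> \<phi>" "m holomorphic_on ball 0 1" "m ` ball 0 1 \<subseteq> ball 0 1"
  shows "holomorphic_disc \<Omega> (\<lambda>\<zeta>. \<phi> (m \<zeta>))"
proof -
  have "((\<lambda>\<zeta>. \<phi> \<zeta> $ i) \<circ> m) holomorphic_on ball 0 1" for i
    using assms by (intro holomorphic_on_compose_gen[OF assms(2)]) (auto simp: holomorphic_disc_def)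
  then show ?thesis
    using assms unfolding holomorphic_disc_def by (auto simp: o_def image_subset_iff)
qed

lemma holomorphic_disc_Moebius:
  assumes "holomorphic_disc \<Omega> \<phi>" "cmod a < 1"
  shows "holomorphic_disc \<Omega> (\<lambda>\<zeta>. \<phi> (Moebius_function 0 a \<zeta>))"
proof (rule holomorphic_disc_compose[OF assms(1) Moebius_function_holomorphic[OF assms(2)]])
  show "Moebius_function 0 a ` ball 0 1 \<subseteq> ball 0 1"
    using Moebius_function_norm_lt_1[OF assms(2)] by auto
qed

text \<open>For \<open>r = tanh t\<close> this derivative agrees with that of \<open>tanh\<close> at
  \<open>t\<close>. Hence a disc recentred by this automorphism has at 0 the same velocity as the
  curve traced along \<open>tanh\<close> at time \<open>t\<close>.\<close>

lemma Moebius_function_deriv_0: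
  "(Moebius_function 0 (- of_real r) has_field_derivative of_real (1 - r\<^sup>2)) (at 0)"
proof -
  have "((\<lambda>z. (z + of_real r) / (1 + of_real r * z)) has_field_derivative
      of_real (1 - r\<^sup>2)) (at (0::complex))"
    by (rule derivative_eq_intros refl | simp add: power2_eq_square)+
  then show ?thesis
    by (simp add: Moebius_function_simple[abs_def])
qed

text \<open>Unit Poincare speed of \<open>tanh\<close> makes the disc itself a chain of length
  \<open>t - s\<close> between times \<open>s\<close> and \<open>t\<close>. The metric bound follows
  by recentring the disc at the current point and applying \<open>kobayashi_metric_le\<close>;
  continuity of the velocity gives the Lipschitz constant.\<close>

lemma disc_curve_tanh:
  assumes \<phi>: "holomorphic_disc \<Omega> \<phi>" and "L \<ge> 0"
  shows "disc_curve \<Omega> L (\<lambda>t. \<phi> (of_real (tanh t)))"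
proof -
  define D where "D i = deriv (\<lambda>\<zeta>. \<phi> \<zeta> $ i)" for i
  define v where "v t = (\<chi> i. of_real (1 - (tanh t)\<^sup>2) * D i (of_real (tanh t)))" for t
  have mem: "of_real (tanh t) \<in> ball (0::complex) 1" for t :: real
    using tanh_real_bounds[of t] by (simp add: abs_less_iff)
  have hol: "(\<lambda>\<zeta>. \<phi> \<zeta> $ i) holomorphic_on ball 0 1" for i
    using \<phi> by (auto simp: holomorphic_disc_def)
  have D: "((\<lambda>\<zeta>. \<phi> \<zeta> $ i) has_field_derivative D i (of_real (tanh t))) (at (of_real (tanh t)))"
    for i and t :: real
    unfolding D_def by (rule holomorphic_derivI[OF hol open_ball mem])
  have tanh': "((\<lambda>t. complex_of_real (tanh t)) has_vector_derivative of_real (1 - (tanh t)\<^sup>2)) (at t)" for t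
    by (rule has_vector_derivative_of_real)
      (auto intro!: derivative_eq_intros simp flip: has_real_derivative_iff_has_vector_derivative)
  have \<sigma>': "((\<lambda>t. \<phi> (of_real (tanh t))) has_vector_derivative v t) (at t)" for t
    by (rule has_vector_derivative_vec)
      (use field_vector_diff_chain_at[OF tanh' D] in \<open>auto simp: v_def o_def\<close>)
  have cont: "continuous_on {0..L} v"
  proof -
    have "continuous_on (ball 0 1) (D i)" for i
      unfolding D_def by (intro holomorphic_on_imp_continuous_on holomorphic_deriv hol open_ball)
    then have "continuous_on {0..L} (\<lambda>t. D i (of_real (tanh t)))" for i
      by (rule continuous_on_compose2) (intro continuous_intros image_subsetI mem | simp)+
    then show ?thesis
      unfolding v_def by (intro continuous_intros) auto
  qed
  have metric: "kobayashi_metric \<Omega> (\<phi> (of_real (tanh t))) (v t) \<le> 1" for t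
  proof -
    let ?m = "Moebius_function 0 (- of_real (tanh t))"
    have "holomorphic_disc \<Omega> (\<lambda>\<zeta>. \<phi> (?m \<zeta>))"
      using holomorphic_disc_Moebius[OF \<phi>, of "- of_real (tanh t)"] mem[of t] by simp
    note le = kobayashi_metric_le[OF this]
    have m0: "?m 0 = of_real (tanh t)"
      by (simp add: Moebius_function_of_zero)
    have "((\<lambda>\<zeta>. \<phi> (?m \<zeta>) $ i) has_field_derivative v t $ i) (at 0)" for i
    proof -
      have 1: "(\<lambda>\<zeta>. \<phi> (?m \<zeta>) $ i) = (\<lambda>\<zeta>. \<phi> \<zeta> $ i) \<circ> ?m"
        by (simp add: o_def)
      have 2: "v t $ i = D i (?m 0) * of_real (1 - (tanh t)\<^sup>2)"
        by (simp add: v_def m0 mult.commute)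
      have "((\<lambda>\<zeta>. \<phi> \<zeta> $ i) has_field_derivative D i (?m 0)) (at (?m 0))"
        unfolding m0 by (rule D)
      then show ?thesis
        unfolding 1 2 by (rule DERIV_chain[OF _ Moebius_function_deriv_0])
    qed
    then have "(\<chi> i. deriv (\<lambda>\<zeta>. \<phi> (?m \<zeta>) $ i) 0) = v t"
      by (simp add: vec_eq_iff DERIV_imp_deriv)
    with le m0 show ?thesis
      by simp
  qed
  show ?thesis
    unfolding disc_curve_def
  proof (intro conjI allI impI)
    show "(\<lambda>t. \<phi> (of_real (tanh t))) ` {0..L} \<subseteq> \<Omega>"
      using mem \<phi> unfolding holomorphic_disc_def by blast
    show "\<exists>B. B-lipschitz_on {0..L} (\<lambda>t. \<phi> (of_real (tanh t)))"
      by (rule C1_curve_lipschitz[OF \<sigma>' cont])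
    show "\<exists>S. finite S \<and> (\<forall>t\<in>{0<..<L} - S. \<exists>v. ((\<lambda>t. \<phi> (of_real (tanh t))) has_vector_derivative v) (at t)
        \<and> kobayashi_metric \<Omega> (\<phi> (of_real (tanh t))) v \<le> 1)"
      using \<sigma>' metric by blast
  next
    fix s t :: real assume "s \<le> t"
    then show "disc_chain \<Omega> (\<phi> (of_real (tanh s))) (\<phi> (of_real (tanh t))) (t - s)"
      using disc_chain_single[OF \<phi>, of "of_real (tanh s)" "of_real (tanh t)"]
        mem[of s] mem[of t] poincare_dist_tanh by simp
  qed fact
qed

text \<open>After a change of parameter the two points sit at 0 and at a nonnegative real number,
  which \<open>tanh\<close> reaches exactly at time \<open>poincare_dist a b\<close>.\<close>

lemma disc_curve_of_disc:
  assumes "holomorphic_disc \<Omega> \<phi>" "cmod a < 1" "cmod b < 1"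
  shows "\<exists>\<sigma>. disc_curve \<Omega> (poincare_dist a b) \<sigma> \<and> \<sigma> 0 = \<phi> a \<and> \<sigma> (poincare_dist a b) = \<phi> b"
proof -
  define c where "c = Moebius_function 0 a b"
  \<comment> \<open>\<open>m\<close> rotates by \<open>sgn c\<close>, which takes
    \<open>cmod c\<close> to \<open>c\<close>, and then undoes the automorphism sending
    \<open>a\<close> to 0 and \<open>b\<close> to \<open>c\<close>. If \<open>a = b\<close>, then
    \<open>c = 0\<close>, and since \<open>sgn 0 = 0\<close> the map \<open>m\<close> is constantly
    \<open>a\<close>, which still serves.\<close>
  define m where "m \<zeta> = Moebius_function 0 (- a) (sgn c * \<zeta>)" for \<zeta>
  define \<psi> where "\<psi> \<zeta> = \<phi> (m \<zeta>)" for \<zeta>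
  have c: "cmod c < 1"
    unfolding c_def using assms by (intro Moebius_function_norm_lt_1)
  have rot: "cmod (sgn c * \<zeta>) < 1" if "cmod \<zeta> < 1" for \<zeta>
    using that by (simp add: norm_mult norm_sgn)
  have "(\<lambda>\<zeta>. sgn c * \<zeta>) holomorphic_on ball 0 1" "cmod (- a) < 1"
    "(\<lambda>\<zeta>. sgn c * \<zeta>) ` ball 0 1 \<subseteq> ball 0 1"
    using assms rot by (auto intro: holomorphic_on_mult holomorphic_on_const holomorphic_on_ident)
  then have "(Moebius_function 0 (- a) \<circ> (\<lambda>\<zeta>. sgn c * \<zeta>)) holomorphic_on ball 0 1"
    by (metis holomorphic_on_compose_gen Moebius_function_holomorphic)
  then have "m holomorphic_on ball 0 1"
    by (simp add: m_def[abs_def] o_def)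
  moreover have "m ` ball 0 1 \<subseteq> ball 0 1"
    using Moebius_function_norm_lt_1[of "- a"] assms(2) rot by (simp add: m_def image_subset_iff)
  ultimately have "holomorphic_disc \<Omega> \<psi>"
    unfolding \<psi>_def by (rule holomorphic_disc_compose[OF assms(1)])
  moreover have len: "poincare_dist a b = artanh (cmod c)"
    by (simp add: poincare_dist_Moebius c_def)
  moreover have "tanh (poincare_dist a b) = cmod c"
    unfolding len using c by (intro tanh_artanh_real) simp
  moreover have "\<psi> 0 = \<phi> a"
    by (simp add: \<psi>_def m_def Moebius_function_of_zero)
  moreover have "sgn c * of_real (cmod c) = c"
    by (simp add: sgn_eq)
  then have "\<psi> (of_real (cmod c)) = \<phi> b"
    using assms by (simp add: \<psi>_def m_def c_def Moebius_function_compose)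
  ultimately show ?thesis
    using disc_curve_tanh[of \<Omega> \<psi> "poincare_dist a b"] poincare_dist_nonneg[OF assms(2,3)]
    by (intro exI[of _ "\<lambda>t. \<psi> (of_real (tanh t))"]) simp
qed

section \<open>Joining and cutting curves\<close>

lemma disc_curve_join:
  assumes \<sigma>: "disc_curve \<Omega> T \<sigma>" and \<tau>: "disc_curve \<Omega> U \<tau>" and eq: "\<sigma> T = \<tau> 0"
  shows "disc_curve \<Omega> (T + U) (\<lambda>t. if t \<le> T then \<sigma> t else \<tau> (t - T))"
    (is "disc_curve _ _ ?\<rho>")
  unfolding disc_curve_def
proof (intro conjI allI impI)
  show "0 \<le> T + U" "?\<rho> ` {0..T + U} \<subseteq> \<Omega>"
    using \<sigma> \<tau> by (auto simp: disc_curve_def)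
next
  fix s t assume st: "0 \<le> s" "s \<le> t" "t \<le> T + U"
  have T: "0 \<le> T" and U: "0 \<le> U"
    and c\<sigma>: "\<And>s t. 0 \<le> s \<Longrightarrow> s \<le> t \<Longrightarrow> t \<le> T \<Longrightarrow> disc_chain \<Omega> (\<sigma> s) (\<sigma> t) (t - s)"
    and c\<tau>: "\<And>s t. 0 \<le> s \<Longrightarrow> s \<le> t \<Longrightarrow> t \<le> U \<Longrightarrow> disc_chain \<Omega> (\<tau> s) (\<tau> t) (t - s)"
    using \<sigma> \<tau> by (auto simp: disc_curve_def)
  consider "t \<le> T" | "s \<le> T" "T < t" | "T < s"
    by linarith
  then show "disc_chain \<Omega> (?\<rho> s) (?\<rho> t) (t - s)"
  proof cases
    case 2
    then show ?thesis
      using disc_chain_trans[of \<Omega> "\<sigma> s" "\<sigma> T" "T - s" "\<tau> (t - T)" "t - T"] c\<sigma>[of s T] c\<tau>[of 0 "t - T"]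
        st T eq by simp
  next
    case 3
    then show ?thesis
      using c\<tau>[of "s - T" "t - T"] st by simp
  qed (use c\<sigma> st in auto)
next
  obtain B C where B: "B-lipschitz_on {0..T} \<sigma>" and C: "C-lipschitz_on {0..U} \<tau>"
    using \<sigma> \<tau> by (auto simp: disc_curve_def)
  have "C-lipschitz_on {T..T + U} (\<lambda>t. \<tau> (t - T))"
  proof (rule lipschitz_onI)
    fix x y assume "x \<in> {T..T + U}" "y \<in> {T..T + U}"
    then show "dist (\<tau> (x - T)) (\<tau> (y - T)) \<le> C * dist x y"
      using lipschitz_onD[OF C, of "x - T" "y - T"] by (simp add: dist_real_def)
  qed (rule lipschitz_on_nonneg[OF C])
  from lipschitz_on_concat_max[OF B this] show "\<exists>B. B-lipschitz_on {0..T + U} ?\<rho>"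
    using eq by auto
next
  obtain S R where "finite S" "finite R"
    and S: "\<And>t. t \<in> {0<..<T} - S \<Longrightarrow> \<exists>v. (\<sigma> has_vector_derivative v) (at t) \<and> kobayashi_metric \<Omega> (\<sigma> t) v \<le> 1"
    and R: "\<And>t. t \<in> {0<..<U} - R \<Longrightarrow> \<exists>v. (\<tau> has_vector_derivative v) (at t) \<and> kobayashi_metric \<Omega> (\<tau> t) v \<le> 1"
    using \<sigma> \<tau> unfolding disc_curve_def by metis
  \<comment> \<open>The joining time \<open>T\<close> becomes exceptional, because the one-sided
    derivatives may differ there; the exceptional times of \<open>\<tau>\<close> are shifted by
    \<open>T\<close>.\<close>
  have "\<exists>v. (?\<rho> has_vector_derivative v) (at t) \<and> kobayashi_metric \<Omega> (?\<rho> t) v \<le> 1"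
    if t: "t \<in> {0<..<T + U} - (insert T S \<union> (\<lambda>t. t + T) ` R)" for t
  proof (cases "t < T")
    case True
    then obtain v where v: "(\<sigma> has_vector_derivative v) (at t)" "kobayashi_metric \<Omega> (\<sigma> t) v \<le> 1"
      using S[of t] t by auto
    have "(?\<rho> has_vector_derivative v) (at t)"
      by (rule has_vector_derivative_transform_within_open[OF v(1), of "{..<T}"]) (use True in auto)
    with v True show ?thesis
      by (intro exI[of _ v]) auto
  next
    case False
    then have "T < t" using t by auto
    moreover have "t - T \<notin> R"
      using t by (force simp: image_iff)
    ultimately obtain v where v: "(\<tau> has_vector_derivative v) (at (t - T))" "kobayashi_metric \<Omega> (\<tau> (t - T)) v \<le> 1"
      using R[of "t - T"] t by auto
    have "((\<tau> \<circ> (\<lambda>t. t - T)) has_vector_derivative 1 *\<^sub>R v) (at t)"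
      by (rule vector_diff_chain_at) (use v in \<open>auto intro!: derivative_eq_intros\<close>)
    then have "((\<lambda>t. \<tau> (t - T)) has_vector_derivative v) (at t)"
      by (simp add: o_def)
    then have "(?\<rho> has_vector_derivative v) (at t)"
      by (rule has_vector_derivative_transform_within_open[of _ _ _ "{T<..}"]) (use \<open>T < t\<close> in auto)
    with v \<open>T < t\<close> show ?thesis
      by (intro exI[of _ v]) auto
  qed
  with \<open>finite S\<close> \<open>finite R\<close> show "\<exists>S. finite S \<and> (\<forall>t\<in>{0<..<T + U} - S.
      \<exists>v. (?\<rho> has_vector_derivative v) (at t) \<and> kobayashi_metric \<Omega> (?\<rho> t) v \<le> 1)"
    by (intro exI[of _ "insert T S \<union> (\<lambda>t. t + T) ` R"]) auto
qed

text \<open>The curves of the successive discs are joined. The assumption on \<open>w\<close> serves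
  the empty chain, whose constant curve has to lie in \<open>\<Omega>\<close>.\<close>

lemma disc_curve_of_disc_chain:
  assumes "disc_chain \<Omega> z w L" "w \<in> \<Omega>"
  shows "\<exists>\<sigma>. disc_curve \<Omega> L \<sigma> \<and> \<sigma> 0 = z \<and> \<sigma> L = w"
  using assms
proof (induction rule: disc_chain.induct)
  case (refl z)
  then show ?case
    using disc_curve_const by blast
next
  case (step \<phi> a b w L)
  obtain \<sigma> where \<sigma>: "disc_curve \<Omega> (poincare_dist a b) \<sigma>" "\<sigma> 0 = \<phi> a" "\<sigma> (poincare_dist a b) = \<phi> b"
    using disc_curve_of_disc[OF step.hyps(1-3)] by blast
  obtain \<tau> where \<tau>: "disc_curve \<Omega> L \<tau>" "\<tau> 0 = \<phi> b" "\<tau> L = w"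
    using step by blast
  have "0 \<le> poincare_dist a b" "0 \<le> L"
    using poincare_dist_nonneg step.hyps disc_chain_nonneg by blast+
  then show ?case
    using disc_curve_join[OF \<sigma>(1) \<tau>(1)] \<sigma> \<tau>
    by (intro exI[of _ "\<lambda>t. if t \<le> poincare_dist a b then \<sigma> t else \<tau> (t - poincare_dist a b)"])
      (auto simp: antisym)
qed

text \<open>Segments are shifted to start at time 0, the form in which \<open>visible_pair\<close>
  takes its curves.\<close>

lemma disc_curve_segment:
  assumes \<sigma>: "disc_curve \<Omega> T \<sigma>" and ab: "0 \<le> a" "a \<le> b" "b \<le> T"
  shows "disc_curve \<Omega> (b - a) (\<lambda>t. \<sigma> (a + t))"
  unfolding disc_curve_def
proof (intro conjI allI impI)
  show "0 \<le> b - a" "(\<lambda>t. \<sigma> (a + t)) ` {0..b - a} \<subseteq> \<Omega>"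
    using assms by (auto simp: disc_curve_def)
next
  fix s t assume "0 \<le> s" "s \<le> t" "t \<le> b - a"
  moreover have "\<And>s t. 0 \<le> s \<Longrightarrow> s \<le> t \<Longrightarrow> t \<le> T \<Longrightarrow> disc_chain \<Omega> (\<sigma> s) (\<sigma> t) (t - s)"
    using \<sigma> by (simp add: disc_curve_def)
  from this[of "a + s" "a + t"] show "disc_chain \<Omega> (\<sigma> (a + s)) (\<sigma> (a + t)) (t - s)"
    using calculation ab by simp
next
  obtain B where B: "B-lipschitz_on {0..T} \<sigma>"
    using \<sigma> by (auto simp: disc_curve_def)
  have "B-lipschitz_on {0..b - a} (\<lambda>t. \<sigma> (a + t))"
  proof (rule lipschitz_onI)
    fix x y assume "x \<in> {0..b - a}" "y \<in> {0..b - a}"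
    then show "dist (\<sigma> (a + x)) (\<sigma> (a + y)) \<le> B * dist x y"
      using lipschitz_onD[OF B, of "a + x" "a + y"] ab by simp
  qed (rule lipschitz_on_nonneg[OF B])
  then show "\<exists>B. B-lipschitz_on {0..b - a} (\<lambda>t. \<sigma> (a + t))" ..
next
  obtain S where "finite S"
    and S: "\<And>t. t \<in> {0<..<T} - S \<Longrightarrow> \<exists>v. (\<sigma> has_vector_derivative v) (at t) \<and> kobayashi_metric \<Omega> (\<sigma> t) v \<le> 1"
    using \<sigma> unfolding disc_curve_def by metis
  have "\<exists>v. ((\<lambda>t. \<sigma> (a + t)) has_vector_derivative v) (at t) \<and> kobayashi_metric \<Omega> (\<sigma> (a + t)) v \<le> 1"
    if t: "t \<in> {0<..<b - a} - (\<lambda>t. t - a) ` S" for t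
  proof -
    have "a + t \<notin> S"
      using t by (force simp: image_iff)
    then obtain v where v: "(\<sigma> has_vector_derivative v) (at (a + t))" "kobayashi_metric \<Omega> (\<sigma> (a + t)) v \<le> 1"
      using S[of "a + t"] t ab by auto
    have "((\<sigma> \<circ> (\<lambda>t. a + t)) has_vector_derivative 1 *\<^sub>R v) (at t)"
      by (rule vector_diff_chain_at) (use v in \<open>auto intro!: derivative_eq_intros\<close>)
    with v show ?thesis
      by (auto simp: o_def)
  qed
  with \<open>finite S\<close> show "\<exists>S. finite S \<and> (\<forall>t\<in>{0<..<b - a} - S.
      \<exists>v. ((\<lambda>t. \<sigma> (a + t)) has_vector_derivative v) (at t) \<and> kobayashi_metric \<Omega> (\<sigma> (a + t)) v \<le> 1)"
    by (intro exI[of _ "(\<lambda>t. t - a) ` S"]) auto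
qed

lemma disc_curve_near_optimal_segment:
  assumes \<sigma>: "disc_curve \<Omega> T \<sigma>" and opt: "T < kobayashi_dist \<Omega> (\<sigma> 0) (\<sigma> T) + \<kappa>"
    and ab: "0 \<le> a" "a \<le> b" "b \<le> T"
  shows "b - a < kobayashi_dist \<Omega> (\<sigma> a) (\<sigma> b) + \<kappa>"
proof -
  have chain: "\<And>s t. 0 \<le> s \<Longrightarrow> s \<le> t \<Longrightarrow> t \<le> T \<Longrightarrow> disc_chain \<Omega> (\<sigma> s) (\<sigma> t) (t - s)"
    using \<sigma> by (simp add: disc_curve_def)
  have "disc_chain \<Omega> (\<sigma> a) (\<sigma> b) (b - a)" "\<kappa> + kobayashi_dist \<Omega> (\<sigma> 0) (\<sigma> T) - T > 0"
    using chain ab opt by auto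
  then obtain L where L: "disc_chain \<Omega> (\<sigma> a) (\<sigma> b) L"
    "L < kobayashi_dist \<Omega> (\<sigma> a) (\<sigma> b) + (\<kappa> + kobayashi_dist \<Omega> (\<sigma> 0) (\<sigma> T) - T)"
    by (rule disc_chain_near_optimal)
  have "disc_chain \<Omega> (\<sigma> 0) (\<sigma> T) ((a - 0) + (L + (T - b)))"
    using chain ab by (intro disc_chain_trans[OF chain disc_chain_trans[OF L(1) chain]]) auto
  then have "kobayashi_dist \<Omega> (\<sigma> 0) (\<sigma> T) \<le> a + (L + (T - b))"
    by (auto dest: kobayashi_dist_le)
  with L(2) show ?thesis
    by simp
qed

lemma kobayashi_dist_commute: "kobayashi_dist \<Omega> z w = kobayashi_dist \<Omega> w z"
proof -
  have "disc_chain \<Omega> z w = disc_chain \<Omega> w z"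
    using disc_chain_sym by blast
  then show ?thesis
    by (simp add: kobayashi_dist_disc_chain)
qed

section \<open>From disc curves to almost-geodesics\<close>

lemma lipschitz_imp_absolutely_continuous:
  assumes B: "B-lipschitz_on I \<sigma>"
  shows "absolutely_continuous_curve_on I \<sigma>"
  unfolding absolutely_continuous_curve_on_def
proof (intro allI impI)
  fix \<epsilon> :: real assume "\<epsilon> > 0"
  have B0: "0 \<le> B" by (rule lipschitz_on_nonneg[OF B])
  show "\<exists>\<delta>>0. \<forall>(n::nat) s t. (\<forall>i<n. s i \<in> I \<and> t i \<in> I \<and> s i \<le> t i) \<and>
      (\<forall>i<n. \<forall>j<n. i \<noteq> j \<longrightarrow> {s i<..<t i} \<inter> {s j<..<t j} = {}) \<and> (\<Sum>i<n. t i - s i) < \<delta> \<longrightarrow>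
      (\<Sum>i<n. norm (\<sigma> (t i) - \<sigma> (s i))) < \<epsilon>"
  \<comment> \<open>Dividing by \<open>B + 1\<close> rather than \<open>B\<close> covers the case
    \<open>B = 0\<close>.\<close>
  proof (intro exI[of _ "\<epsilon> / (B + 1)"] conjI allI impI)
    show "0 < \<epsilon> / (B + 1)"
      using B0 \<open>\<epsilon> > 0\<close> by simp
  next
    fix n :: nat and s t :: "nat \<Rightarrow> real"
    assume "(\<forall>i<n. s i \<in> I \<and> t i \<in> I \<and> s i \<le> t i) \<and>
      (\<forall>i<n. \<forall>j<n. i \<noteq> j \<longrightarrow> {s i<..<t i} \<inter> {s j<..<t j} = {}) \<and> (\<Sum>i<n. t i - s i) < \<epsilon> / (B + 1)"
    then have st: "\<And>i. i < n \<Longrightarrow> s i \<in> I \<and> t i \<in> I \<and> s i \<le> t i"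
      and small: "(\<Sum>i<n. t i - s i) < \<epsilon> / (B + 1)"
      by auto
    have "(\<Sum>i<n. norm (\<sigma> (t i) - \<sigma> (s i))) \<le> (\<Sum>i<n. (B + 1) * (t i - s i))"
    proof (rule sum_mono)
      fix i assume "i \<in> {..<n}"
      then have i: "s i \<in> I" "t i \<in> I" "s i \<le> t i" using st by auto
      have "norm (\<sigma> (t i) - \<sigma> (s i)) \<le> B * (t i - s i)"
        using lipschitz_onD[OF B i(2,1)] i(3) by (simp add: dist_norm)
      also have "\<dots> \<le> (B + 1) * (t i - s i)"
        using i(3) by (simp add: algebra_simps)
      finally show "norm (\<sigma> (t i) - \<sigma> (s i)) \<le> (B + 1) * (t i - s i)" .
    qed
    also have "\<dots> = (B + 1) * (\<Sum>i<n. t i - s i)"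
      by (simp add: sum_distrib_left)
    also have "\<dots> < \<epsilon>"
      using small B0 by (simp add: field_simps)
    finally show "(\<Sum>i<n. norm (\<sigma> (t i) - \<sigma> (s i))) < \<epsilon>" .
  qed
qed

text \<open>The upper distance bound comes from the chain that the curve follows, the lower one from
  the near-optimality of each of its segments.\<close>

lemma almost_geodesic_disc_curve:
  assumes \<sigma>: "disc_curve \<Omega> T \<sigma>" and opt: "T < kobayashi_dist \<Omega> (\<sigma> 0) (\<sigma> T) + \<kappa>" and "\<kappa> > 0"
  shows "almost_geodesic \<Omega> 1 \<kappa> {0..T} \<sigma>"
  unfolding almost_geodesic_def
proof (intro conjI ballI)
  show "\<sigma> ` {0..T} \<subseteq> \<Omega>"
    using \<sigma> by (simp add: disc_curve_def)
  have le: "\<bar>s - t\<bar> - \<kappa> \<le> kobayashi_dist \<Omega> (\<sigma> s) (\<sigma> t) \<and> kobayashi_dist \<Omega> (\<sigma> s) (\<sigma> t) \<le> \<bar>s - t\<bar> + \<kappa>"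
    if "0 \<le> s" "s \<le> t" "t \<le> T" for s t
  proof -
    have "kobayashi_dist \<Omega> (\<sigma> s) (\<sigma> t) \<le> t - s"
      using \<sigma> that by (intro kobayashi_dist_le) (simp add: disc_curve_def)
    then show ?thesis
      using disc_curve_near_optimal_segment[OF \<sigma> opt that] that \<open>\<kappa> > 0\<close> by linarith
  qed
  fix s t assume "s \<in> {0..T}" "t \<in> {0..T}"
  then show "1 / 1 * \<bar>s - t\<bar> - \<kappa> \<le> kobayashi_dist \<Omega> (\<sigma> s) (\<sigma> t)"
    "kobayashi_dist \<Omega> (\<sigma> s) (\<sigma> t) \<le> 1 * \<bar>s - t\<bar> + \<kappa>"
    using le[of s t] le[of t s] kobayashi_dist_commute[of \<Omega> "\<sigma> s" "\<sigma> t"]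
    by (cases "s \<le> t"; simp)+
next
  show "absolutely_continuous_curve_on {0..T} \<sigma>"
    using \<sigma> lipschitz_imp_absolutely_continuous unfolding disc_curve_def by blast
  obtain S where "finite S"
    and S: "\<And>t. t \<in> {0<..<T} - S \<Longrightarrow> \<exists>v. (\<sigma> has_vector_derivative v) (at t) \<and> kobayashi_metric \<Omega> (\<sigma> t) v \<le> 1"
    using \<sigma> unfolding disc_curve_def by metis
  \<comment> \<open>The end points join the null set, since \<open>disc_curve\<close> provides
    derivatives only at interior times.\<close>
  have "AE t in lebesgue. t \<notin> insert 0 (insert T S)"
    using \<open>finite S\<close> by (intro AE_not_in) (simp add: negligible_finite flip: negligible_iff_null_sets)
  then show "AE t in lebesgue. t \<in> {0..T} \<longrightarrow>
      (\<exists>v. (\<sigma> has_vector_derivative v) (at t within {0..T}) \<and> kobayashi_metric \<Omega> (\<sigma> t) v \<le> 1)"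
  proof eventually_elim
    case (elim t)
    then show ?case
      using S[of t] has_vector_derivative_at_within by fastforce
  qed
qed auto

text \<open>The property is recorded for all segments, because the curves fed to visibility will be
  pieces cut out of a longer one.\<close>

lemma almost_geodesic_curve_exists:
  assumes "open \<Omega>" "connected \<Omega>" "z \<in> \<Omega>" "w \<in> \<Omega>" "\<kappa> > 0"
  obtains T \<sigma> where "0 \<le> T" "\<sigma> 0 = z" "\<sigma> T = w" "continuous_on {0..T} \<sigma>" "\<sigma> ` {0..T} \<subseteq> \<Omega>"
    "\<And>a b. 0 \<le> a \<Longrightarrow> a \<le> b \<Longrightarrow> b \<le> T \<Longrightarrow> almost_geodesic \<Omega> 1 \<kappa> {0..b - a} (\<lambda>t. \<sigma> (a + t))"
proof -
  obtain M where "disc_chain \<Omega> z w M"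
    using disc_chain_exists[OF assms(1-4)] by blast
  then obtain T where T: "disc_chain \<Omega> z w T" "T < kobayashi_dist \<Omega> z w + \<kappa>"
    using disc_chain_near_optimal assms(5) by blast
  obtain \<sigma> where \<sigma>: "disc_curve \<Omega> T \<sigma>" "\<sigma> 0 = z" "\<sigma> T = w"
    using disc_curve_of_disc_chain[OF T(1) assms(4)] by blast
  show thesis
  proof
    show "0 \<le> T" "\<sigma> ` {0..T} \<subseteq> \<Omega>"
      using \<sigma> by (auto simp: disc_curve_def)
    fix a b assume ab: "0 \<le> a" "a \<le> b" "b \<le> T"
    then show "almost_geodesic \<Omega> 1 \<kappa> {0..b - a} (\<lambda>t. \<sigma> (a + t))"
      using disc_curve_near_optimal_segment[OF \<sigma>(1) _ ab] T(2) \<sigma> assms(5)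
      by (intro almost_geodesic_disc_curve disc_curve_segment[OF \<sigma>(1) ab]) auto
  qed (use \<sigma> disc_curve_continuous in auto)
qed

section \<open>Compact exhaustions and the end compactification\<close>

lemma compact_exhaustionD:
  assumes "compact_exhaustion X K"
  shows "compact (K j)" "K j \<subseteq> (top_of_set X) interior_of K (Suc j)" "K j \<subseteq> X" "K j \<subseteq> K (Suc j)"
  using assms interior_of_subset[of "top_of_set X" "K (Suc j)"]
  unfolding compact_exhaustion_def by blast+

lemma compact_exhaustion_mono:
  assumes "compact_exhaustion X K" "i \<le> j" shows "K i \<subseteq> K j"
  using lift_Suc_mono_le[of K, OF compact_exhaustionD(4)[OF assms(1)] assms(2)] .

text \<open>A common notion of position at level \<open>j\<close> for points and ends, so that
  sequences mixing both need no case distinction. It is empty for a point of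
  \<open>K j\<close>.\<close>

definition end_component :: "'a::topological_space set \<Rightarrow> (nat \<Rightarrow> 'a set) \<Rightarrow> nat \<Rightarrow> 'a end_point \<Rightarrow> 'a set"
  where "end_component X K j e =
    (case e of Pt x \<Rightarrow> connected_component_set (X - K j) x | End G \<Rightarrow> G j)"

lemma end_component_Suc:
  assumes "compact_exhaustion X K" "e \<in> topspace (end_compactification X K)"
  shows "end_component X K (Suc j) e \<subseteq> end_component X K j e"
proof (cases e)
  case (Pt x)
  have "X - K (Suc j) \<subseteq> X - K j"
    using compact_exhaustionD(4)[OF assms(1)] by blast
  then show ?thesis
    by (simp add: end_component_def Pt connected_component_mono)
next
  case (End G)
  then show ?thesis
    using assms(2) by (auto simp: end_component_def topspace_end_compactification ends_def)
qed

text \<open>Outside \<open>K n\<close> lies the point itself or, for an end \<open>G\<close>, any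
  point of \<open>G n\<close>, which is contained in \<open>G j\<close>.\<close>

lemma end_component_far:
  assumes K: "compact_exhaustion X K" and e: "e \<in> topspace (end_compactification X K)" "e \<notin> Pt ` K n"
    and "j \<le> n"
  shows "end_component X K j e \<in> components (X - K j)" "end_component X K j e - K n \<noteq> {}"
proof -
  have "end_component X K j e \<in> components (X - K j) \<and> end_component X K j e - K n \<noteq> {}"
  proof (cases e)
    case (Pt x)
    then have "x \<in> X - K n" "x \<in> X - K j"
      using e compact_exhaustion_mono[OF K \<open>j \<le> n\<close>] by (auto simp: topspace_end_compactification)
    moreover have "end_component X K j e = connected_component_set (X - K j) x"
      by (simp add: end_component_def Pt)
    ultimately show ?thesis
      using connected_component_refl[of x "X - K j"] componentsI[of x "X - K j"] by auto
  next
    case (End G)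
    then have G: "\<And>i. G i \<in> components (X - K i)" "\<And>i. G (Suc i) \<subseteq> G i"
      using e by (auto simp: topspace_end_compactification ends_def)
    have "G n \<subseteq> G j" "G n \<noteq> {}" "G n \<subseteq> X - K n"
      using lift_Suc_antimono_le[of G, OF G(2) \<open>j \<le> n\<close>] in_components_nonempty in_components_subset G(1)
      by blast+
    then show ?thesis
      using G(1) by (auto simp: end_component_def End)
  qed
  then show "end_component X K j e \<in> components (X - K j)" "end_component X K j e - K n \<noteq> {}"
    by auto
qed

section \<open>Convergence in the end compactification\<close>

lemma eventually_Pt_in_open:
  assumes "open_in_ends X K U" "Pt l \<in> U" "\<And>n. x n \<in> X" "x \<longlonglongrightarrow> l"
  shows "\<forall>\<^sub>F n in sequentially. Pt (x n) \<in> U"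
proof -
  obtain V where V: "openin (top_of_set X) V" "l \<in> V" "Pt ` V \<subseteq> U"
    using open_in_endsD(2)[OF assms(1,2)] by blast
  then obtain O' where O': "open O'" "V = X \<inter> O'"
    by (auto simp: openin_open)
  have "\<forall>\<^sub>F n in sequentially. x n \<in> O'"
    using assms(4) O' V(2) by (auto intro: topological_tendstoD)
  then show ?thesis
    by eventually_elim (use O' V assms(3) in auto)
qed

text \<open>If some \<open>K j\<close> contains infinitely many terms, its compactness gives a limit
  in \<open>X\<close>. Otherwise the terms leave every \<open>K j\<close>, and by \<open>fin\<close>
  and the pigeonhole principle a subsequence stays in one component at each level; the diagonal
  sequence does so eventually at all levels.\<close>

lemma sequentially_compact_end_compactification:
  fixes X :: "'a::metric_space set"
  assumes K: "compact_exhaustion X K"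
    and fin: "\<And>j. \<exists>n\<ge>j. finite {C \<in> components (X - K j). C - K n \<noteq> {}}"
  shows "sequentially_compact_space (end_compactification X K)"
  unfolding sequentially_compact_space_def
proof (intro allI impI)
  fix f :: "nat \<Rightarrow> 'a end_point"
  assume "range f \<subseteq> topspace (end_compactification X K)"
  then have f: "f n \<in> topspace (end_compactification X K)" for n
    by auto
  show "\<exists>l r. l \<in> topspace (end_compactification X K) \<and> strict_mono (r :: nat \<Rightarrow> nat) \<and>
    limitin (end_compactification X K) (f \<circ> r) l sequentially"
  proof (cases "\<exists>j. infinite {n. f n \<in> Pt ` K j}")
    case True
    then obtain j where "infinite {n. f n \<in> Pt ` K j}" ..
    then obtain r :: "nat \<Rightarrow> nat" where r: "strict_mono r" "\<And>n. f (r n) \<in> Pt ` K j"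
      using infinite_enumerate by blast
    then obtain x where x: "\<And>n. f (r n) = Pt (x n)" "\<And>n. x n \<in> K j"
      unfolding image_iff by metis
    obtain l s where l: "l \<in> K j" "strict_mono s" "(x \<circ> s) \<longlonglongrightarrow> l"
      using compact_exhaustionD(1)[OF K, of j] x(2) unfolding compact_def by meson
    have inX: "(x \<circ> s) n \<in> X" "l \<in> X" for n
      using compact_exhaustionD(3)[OF K] x(2) l(1) by auto
    show ?thesis
    proof (intro exI[of _ "Pt l"] exI[of _ "r \<circ> s"] conjI)
      show top: "Pt l \<in> topspace (end_compactification X K)"
        using inX by (simp add: topspace_end_compactification)
      show "strict_mono (r \<circ> s)"
        using r(1) l(2) by (rule strict_mono_o)
      show "limitin (end_compactification X K) (f \<circ> (r \<circ> s)) (Pt l) sequentially"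
        using eventually_Pt_in_open[OF _ _ inX(1) l(3)] top
        by (auto simp: limitin_def openin_end_compactification x(1))
    qed
  next
    case False
    \<comment> \<open>\<open>P j s\<close> says that all terms along \<open>s\<close> have the same
      component at level \<open>j\<close>, a property inherited by subsequences.\<close>
    define P where "P j s \<longleftrightarrow> (\<exists>C\<in>components (X - K j). \<forall>i. end_component X K j (f (s i)) = C)"
      for j and s :: "nat \<Rightarrow> nat"
    interpret subseqs P
    proof
      fix j and s :: "nat \<Rightarrow> nat" assume s: "strict_mono s"
      obtain n where n: "j \<le> n" "finite {C \<in> components (X - K j). C - K n \<noteq> {}}" (is "finite ?S")
        using fin by blast
      define A where "A = {i. f (s i) \<notin> Pt ` K n}"
      have "finite (s -` {n'. f n' \<in> Pt ` K n})"
        using False s by (intro finite_vimageI) (auto dest: strict_mono_imp_inj_on)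
      then have "infinite A"
        unfolding A_def using finite_Collect_not by (auto simp: vimage_def)
      moreover have S: "end_component X K j (f (s i)) \<in> ?S" if "i \<in> A" for i
        using end_component_far[OF K f _ n(1)] that by (auto simp: A_def)
      then have "finite ((\<lambda>i. end_component X K j (f (s i))) ` A)"
        by (intro finite_subset[OF image_subsetI n(2)])
      ultimately obtain i0 where i0: "i0 \<in> A"
        "infinite {i\<in>A. end_component X K j (f (s i)) = end_component X K j (f (s i0))}"
        using pigeonhole_infinite by blast
      obtain r :: "nat \<Rightarrow> nat" where r: "strict_mono r"
        "\<And>n. r n \<in> {i\<in>A. end_component X K j (f (s i)) = end_component X K j (f (s i0))}"
        using infinite_enumerate[OF i0(2)] by blast
      then have "P j (s \<circ> r)"
        using S[OF i0(1)] by (auto simp: P_def)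
      with r(1) show "\<exists>r. strict_mono r \<and> P j (s \<circ> r)"
        by blast
    qed
    \<comment> \<open>From index \<open>Suc j\<close> on, the diagonal sequence is a subsequence of
      the one selected at level \<open>j\<close>; hence the strict inequality \<open>j < i\<close>
      below.\<close>
    have "P j (diagseq \<circ> (+) (Suc j))" for j
      by (rule diagseq_holds) (auto simp: P_def)
    then obtain F where F: "\<And>j. F j \<in> components (X - K j)"
      "\<And>j i. end_component X K j (f (diagseq (Suc j + i))) = F j"
      unfolding P_def by (simp del: add_Suc) metis
    then have F': "end_component X K j (f (diagseq i)) = F j" if "j < i" for i j
      using that F(2)[of j "i - Suc j"] by simp
    have "F (Suc j) \<subseteq> F j" for j
      \<comment> \<open>The term with index \<open>Suc (Suc j)\<close> is late enough for both
        levels \<open>j\<close> and \<open>Suc j\<close>.\<close>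
      using end_component_Suc[OF K f, of j "diagseq (Suc (Suc j))"] by (simp add: F')
    with F(1) have ends: "F \<in> ends X K"
      by (auto simp: ends_def)
    have nbhd: "f (diagseq i) \<in> end_nbhd X K F j" if "j < i" for i j
    proof (cases "f (diagseq i)")
      case (Pt x)
      then have "connected_component_set (X - K j) x = F j"
        using F'[OF that] by (simp add: end_component_def)
      \<comment> \<open>Components are nonempty, while the connected component of a point outside
        \<open>X - K j\<close> is empty.\<close>
      moreover from this have "x \<in> X - K j"
        using in_components_nonempty[OF F(1)] by (metis connected_component_eq_empty)
      ultimately show ?thesis
        using Pt by (auto simp: end_nbhd_def)
    next
      case (End G)
      have "G \<nu> = F \<nu>" if "\<nu> \<le> j" for \<nu>
        using F'[of \<nu> i] that \<open>j < i\<close> by (simp add: end_component_def End)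
      moreover have "G \<in> ends X K"
        using f[of "diagseq i"] End by (auto simp: topspace_end_compactification)
      ultimately show ?thesis
        using End by (auto simp: end_nbhd_def)
    qed
    have top: "End F \<in> topspace (end_compactification X K)"
      using ends by (simp add: topspace_end_compactification)
    have "limitin (end_compactification X K) (f \<circ> diagseq) (End F) sequentially"
      unfolding limitin_def
    proof (intro conjI allI impI top)
      fix U assume "openin (end_compactification X K) U \<and> End F \<in> U"
      then obtain j where "end_nbhd X K F j \<subseteq> U"
        using open_in_endsD(3) by (metis openin_end_compactification)
      then have "(f \<circ> diagseq) i \<in> U" if "Suc j \<le> i" for i
        using nbhd[of j i] that by auto
      then show "\<forall>\<^sub>F i in sequentially. (f \<circ> diagseq) i \<in> U"
        unfolding eventually_sequentially by blast
    qed
    with top subseq_diagseq show ?thesis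
      by blast
  qed
qed

section \<open>Components of the complement of a compact set\<close>

lemma first_hit:
  fixes \<sigma> :: "real \<Rightarrow> 'a::t2_space"
  assumes cont: "continuous_on {0..T} \<sigma>" and A: "closed A" and "\<sigma> 0 \<notin> A" "0 \<le> t" "t \<le> T" "\<sigma> t \<in> A"
  obtains b where "0 < b" "b \<le> t" "\<sigma> b \<in> A" "\<And>s. 0 \<le> s \<Longrightarrow> s < b \<Longrightarrow> \<sigma> s \<notin> A"
proof -
  let ?S = "{0..t} \<inter> \<sigma> -` A"
  have "continuous_on {0..t} \<sigma>"
    using cont assms(5) by (auto intro: continuous_on_subset)
  then have "closed ?S"
    using A by (intro continuous_closed_preimage) auto
  then have "compact ?S"
    by (metis bounded_Int bounded_closed_interval compact_eq_bounded_closed)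
  moreover have "t \<in> ?S"
    using assms by auto
  ultimately obtain b where b: "b \<in> ?S" "\<And>s. s \<in> ?S \<Longrightarrow> b \<le> s"
    using compact_attains_inf[of ?S] by blast
  show thesis
  proof
    show "0 < b" "b \<le> t" "\<sigma> b \<in> A"
      using b(1) assms(3) by (auto simp: less_le)
    show "\<sigma> s \<notin> A" if "0 \<le> s" "s < b" for s
      using b that by force
  qed
qed

text \<open>A curve from \<open>y\<close> that leaves \<open>U\<close> meets \<open>K j\<close>. The
  crossing runs from its first time \<open>a\<close> in \<open>K (Suc (Suc j))\<close> to its first
  time \<open>b\<close> in \<open>K (Suc j)\<close>. Lying outside a relative interior, unlike lying
  outside \<open>K i\<close>, is a closed condition, so it survives passage to limits of
  crossings.\<close>

lemma almost_geodesic_crosses_shell: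
  assumes \<Omega>: "open \<Omega>" "connected \<Omega>" and K: "compact_exhaustion (closure \<Omega>) K" and "\<kappa> > 0"
    and U: "U \<in> components (\<Omega> - K j)" and y: "y \<in> U - K (Suc (Suc j))" and z: "z \<in> \<Omega> - U"
  shows "\<exists>T \<sigma>. 0 \<le> T \<and> almost_geodesic \<Omega> 1 \<kappa> {0..T} \<sigma> \<and> \<sigma> ` {0..T} \<subseteq> U \<and>
    \<sigma> ` {0..T} \<subseteq> closure \<Omega> - (top_of_set (closure \<Omega>)) interior_of K (Suc j) \<and>
    \<sigma> 0 \<in> K (Suc (Suc j)) - (top_of_set (closure \<Omega>)) interior_of K (Suc (Suc j)) \<and>
    \<sigma> T \<in> K (Suc j)"
proof -
  define I where "I i = (top_of_set (closure \<Omega>)) interior_of K i" for i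
  have closedI: "closed (closure \<Omega> - I i)" for i
  proof -
    have "closedin (top_of_set (closure \<Omega>)) (closure \<Omega> - I i)"
      by (rule closedin_diff) (auto simp: I_def)
    then show ?thesis
      by (auto intro: closedin_closed_trans)
  qed
  have IK: "I i \<subseteq> K i" and KI: "K i \<subseteq> I (Suc i)" and closedK: "closed (K i)" and KS: "K i \<subseteq> K (Suc i)" for i
    using compact_exhaustionD[OF K, of i] interior_of_subset[of "top_of_set (closure \<Omega>)" "K i"]
    by (auto simp: I_def compact_imp_closed)
  have Usub: "U \<subseteq> \<Omega> - K j"
    by (rule in_components_subset[OF U])
  then have "y \<in> \<Omega>" using y by auto
  obtain T \<sigma> where T: "0 \<le> T" and \<sigma>0: "\<sigma> 0 = y" and \<sigma>T: "\<sigma> T = z"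
    and cont: "continuous_on {0..T} \<sigma>" and sub: "\<sigma> ` {0..T} \<subseteq> \<Omega>"
    and geo: "\<And>a b. 0 \<le> a \<Longrightarrow> a \<le> b \<Longrightarrow> b \<le> T \<Longrightarrow> almost_geodesic \<Omega> 1 \<kappa> {0..b - a} (\<lambda>t. \<sigma> (a + t))"
    using almost_geodesic_curve_exists[OF \<Omega> \<open>y \<in> \<Omega>\<close> _ \<open>\<kappa> > 0\<close>, of z] z by blast
  \<comment> \<open>An initial piece missing \<open>K j\<close> is a connected subset of
    \<open>\<Omega> - K j\<close> meeting \<open>U\<close> in \<open>y\<close>, so maximality of the
    component keeps it in \<open>U\<close>.\<close>
  have in_U: "\<sigma> ` {0..b} \<subseteq> U" if "0 \<le> b" "b \<le> T" "\<sigma> ` {0..b} \<inter> K j = {}" for b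
  proof (rule components_maximal[OF U])
    show "connected (\<sigma> ` {0..b})"
      using that cont by (intro connected_continuous_image) (auto intro: continuous_on_subset)
    have "\<sigma> ` {0..b} \<subseteq> \<Omega>"
      using sub that by (auto intro: image_subset_iff[THEN iffD1, THEN bspec])
    then show "\<sigma> ` {0..b} \<subseteq> \<Omega> - K j"
      using that by auto
    have "y \<in> \<sigma> ` {0..b}"
      using \<sigma>0 that by (auto intro: image_eqI[of _ _ 0])
    then show "U \<inter> \<sigma> ` {0..b} \<noteq> {}"
      using y by auto
  qed
  have "\<sigma> ` {0..T} \<inter> K j \<noteq> {}"
  proof
    assume "\<sigma> ` {0..T} \<inter> K j = {}"
    then have "\<sigma> T \<in> U"
      using in_U[of T] T by auto
    with z \<sigma>T show False by auto
  qed
  then obtain t where t: "0 \<le> t" "t \<le> T" "\<sigma> t \<in> K j"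
    by auto
  have "\<sigma> 0 \<notin> K (Suc j)" "\<sigma> 0 \<notin> K (Suc (Suc j))" "\<sigma> t \<in> K (Suc j)"
    using \<sigma>0 y t(3) KS by auto
  then obtain b where b: "0 < b" "b \<le> t" "\<sigma> b \<in> K (Suc j)" "\<And>s. 0 \<le> s \<Longrightarrow> s < b \<Longrightarrow> \<sigma> s \<notin> K (Suc j)"
    using first_hit[OF cont closedK _ t(1,2)] by metis
  have bT: "0 \<le> b" "b \<le> T"
    using b t by auto
  \<comment> \<open>The larger set is also met at time \<open>b\<close>, hence entered no later,
    which gives \<open>a \<le> b\<close>.\<close>
  have "\<sigma> b \<in> K (Suc (Suc j))"
    using b(3) KS by blast
  then obtain a where a: "0 < a" "a \<le> b" "\<sigma> a \<in> K (Suc (Suc j))"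
      "\<And>s. 0 \<le> s \<Longrightarrow> s < a \<Longrightarrow> \<sigma> s \<notin> K (Suc (Suc j))"
    using first_hit[OF cont closedK \<open>\<sigma> 0 \<notin> K (Suc (Suc j))\<close> bT] by metis
  \<comment> \<open>At time \<open>c\<close> the curve may touch \<open>K i\<close>, but by
    continuity it still lies in the closed set \<open>closure \<Omega> - I i\<close>.\<close>
  have avoid: "\<sigma> ` {0..c} \<subseteq> closure \<Omega> - I i"
    if "0 < c" "c \<le> T" "\<And>s. 0 \<le> s \<Longrightarrow> s < c \<Longrightarrow> \<sigma> s \<notin> K i" for c i
  proof -
    have cl: "closure {0..<c} = {0..c}"
      using that(1) by simp
    have "\<sigma> s \<in> closure \<Omega> - I i" if "s \<in> {0..<c}" for s
    proof -
      have "\<sigma> s \<in> \<Omega>"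
        using sub that \<open>c \<le> T\<close> by (auto simp: image_subset_iff)
      then show ?thesis
        using \<open>\<And>s. 0 \<le> s \<Longrightarrow> s < c \<Longrightarrow> \<sigma> s \<notin> K i\<close>[of s] that IK closure_subset by fastforce
    qed
    moreover have "continuous_on {0..c} \<sigma>"
      using cont that(2) by (auto intro: continuous_on_subset)
    ultimately show ?thesis
      using image_closure_subset[of "{0..<c}" \<sigma>, unfolded cl] closedI by blast
  qed
  have avoid_b: "\<sigma> ` {0..b} \<subseteq> closure \<Omega> - I (Suc j)"
    using b(4) bT b(1) by (intro avoid)
  have "\<sigma> ` {0..a} \<subseteq> closure \<Omega> - I (Suc (Suc j))"
    using a bT by (intro avoid) auto
  moreover have "\<sigma> a \<in> \<sigma> ` {0..a}"
    using a(1) by simp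
  ultimately have avoid_a: "\<sigma> a \<notin> I (Suc (Suc j))"
    by blast
  have segment: "(\<lambda>t. \<sigma> (a + t)) ` {0..b - a} \<subseteq> \<sigma> ` {0..b}"
    using a by auto
  have "\<sigma> ` {0..b} \<subseteq> U"
    using avoid_b KI[of j] by (intro in_U[OF bT]) auto
  with segment have "(\<lambda>t. \<sigma> (a + t)) ` {0..b - a} \<subseteq> U"
    "(\<lambda>t. \<sigma> (a + t)) ` {0..b - a} \<subseteq> closure \<Omega> - I (Suc j)"
    by (rule order_trans, intro order_trans[OF segment avoid_b])
  then show ?thesis
    using geo[of a b] a(1-3) b(3) bT avoid_a
    by (intro exI[of _ "b - a"] exI[of _ "\<lambda>t. \<sigma> (a + t)"]) (simp add: I_def)
qed

section \<open>Finiteness of the components reaching far out\<close>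

text \<open>Components of an open set are open here, so a limit in \<open>\<Omega> - A\<close> would
  have a component containing almost all \<open>x n\<close>. Almost all \<open>U n\<close> would
  then coincide with it.\<close>

lemma limit_of_distinct_components:
  fixes \<Omega> :: "'a::real_normed_vector set"
  assumes "open \<Omega>" "closed A" and "\<And>n::nat. U n \<in> components (\<Omega> - A)" "inj U"
    and "\<And>n. x n \<in> U n" "x \<longlonglongrightarrow> l"
  shows "l \<notin> \<Omega> - A"
proof
  assume l: "l \<in> \<Omega> - A"
  have op: "open (\<Omega> - A)"
    using assms by auto
  let ?C = "connected_component_set (\<Omega> - A) l"
  have "\<forall>\<^sub>F n in sequentially. x n \<in> ?C"
    using l by (intro topological_tendstoD[OF assms(6)] open_connected_component op) auto
  then obtain N where N: "\<And>n. n \<ge> N \<Longrightarrow> x n \<in> ?C"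
    unfolding eventually_sequentially by blast
  have "U n = ?C" if "n \<ge> N" for n
    using N[OF that] assms(5)[of n] components_eq[OF assms(3)[of n] componentsI[OF l]] by blast
  from this[of N] this[of "Suc N"] have "U N = U (Suc N)"
    by simp
  from injD[OF \<open>inj U\<close> this] show False
    by simp
qed

text \<open>\<open>limit_of_distinct_components\<close> is used three times: it places the limits
  \<open>q\<close> and \<open>p\<close> of the start and end points of the crossings on the
  boundary, and it contradicts the limit \<open>m\<close> of the points where the crossings meet the
  compact set \<open>C\<close>.\<close>

lemma finite_components_meeting_far:
  assumes \<Omega>: "open \<Omega>" "connected \<Omega>" and K: "compact_exhaustion (closure \<Omega>) K"
    and "\<kappa> > 0" and vis: "visibility_property \<Omega> K 1 \<kappa>"
  shows "finite {U \<in> components (\<Omega> - K j). U - K (Suc (Suc j)) \<noteq> {}}"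
proof (rule ccontr)
  assume "infinite {U \<in> components (\<Omega> - K j). U - K (Suc (Suc j)) \<noteq> {}}"
  then obtain U :: "nat \<Rightarrow> (complex ^ 'a) set" where U: "inj U"
    "range U \<subseteq> {U \<in> components (\<Omega> - K j). U - K (Suc (Suc j)) \<noteq> {}}"
    using infinite_countable_subset by blast
  then have U: "inj U" "\<And>n. U n \<in> components (\<Omega> - K j)" "\<And>n. U n - K (Suc (Suc j)) \<noteq> {}"
    by blast+
  define X where "X = closure \<Omega>"
  define I where "I i = (top_of_set X) interior_of K i" for i
  have closedI: "closed (X - I i)" for i
  proof -
    have "closedin (top_of_set X) (X - I i)"
      by (rule closedin_diff) (auto simp: I_def)
    then show ?thesis
      by (auto simp: X_def intro: closedin_closed_trans)
  qed
  have KI: "K i \<subseteq> I (Suc i)" and compactK: "compact (K i)" and KX: "K i \<subseteq> X"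
    and KS: "K i \<subseteq> K (Suc i)" for i
    using compact_exhaustionD[OF K, of i] by (auto simp: I_def X_def)
  have "\<exists>T \<sigma>. 0 \<le> T \<and> almost_geodesic \<Omega> 1 \<kappa> {0..T} \<sigma> \<and> \<sigma> ` {0..T} \<subseteq> U n \<and>
      \<sigma> ` {0..T} \<subseteq> X - I (Suc j) \<and> \<sigma> 0 \<in> K (Suc (Suc j)) - I (Suc (Suc j)) \<and> \<sigma> T \<in> K (Suc j)" for n
  proof -
    obtain y where y: "y \<in> U n - K (Suc (Suc j))"
      using U(3) by blast
    have "U (Suc n) \<noteq> U n"
      using injD[OF U(1), of "Suc n" n] by auto
    \<comment> \<open>Another component is nonempty and disjoint from \<open>U n\<close>, so it
      supplies a target outside \<open>U n\<close>.\<close>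
    then obtain z where "z \<in> \<Omega> - U n"
      using components_eq[OF U(2) U(2), of "Suc n" n] in_components_nonempty[OF U(2), of "Suc n"]
        in_components_subset[OF U(2), of "Suc n"] by blast
    from almost_geodesic_crosses_shell[OF \<Omega> K \<open>\<kappa> > 0\<close> U(2) y this] show ?thesis
      by (simp add: X_def I_def)
  qed
  then obtain T \<sigma> where \<sigma>: "\<And>n. 0 \<le> T n" "\<And>n. almost_geodesic \<Omega> 1 \<kappa> {0..T n} (\<sigma> n)"
      "\<And>n. \<sigma> n ` {0..T n} \<subseteq> U n" "\<And>n. \<sigma> n ` {0..T n} \<subseteq> X - I (Suc j)"
      "\<And>n. \<sigma> n 0 \<in> K (Suc (Suc j)) - I (Suc (Suc j))" "\<And>n. \<sigma> n (T n) \<in> K (Suc j)"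
    by metis
  \<comment> \<open>Compactness of the product yields one subsequence along which both end points
    converge.\<close>
  have "compact (K (Suc (Suc j)) \<times> K (Suc j))"
    by (intro compact_Times compactK)
  moreover have "\<forall>n. (\<sigma> n 0, \<sigma> n (T n)) \<in> K (Suc (Suc j)) \<times> K (Suc j)"
    using \<sigma>(5,6) by auto
  ultimately obtain l and r :: "nat \<Rightarrow> nat" where r: "strict_mono r"
    and l: "l \<in> K (Suc (Suc j)) \<times> K (Suc j)" "((\<lambda>n. (\<sigma> n 0, \<sigma> n (T n))) \<circ> r) \<longlonglongrightarrow> l"
    unfolding compact_def by meson
  define q p where "q = fst l" and "p = snd l"
  have q: "(\<lambda>n. \<sigma> (r n) 0) \<longlonglongrightarrow> q" and p: "(\<lambda>n. \<sigma> (r n) (T (r n))) \<longlonglongrightarrow> p"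
    using tendsto_fst[OF l(2)] tendsto_snd[OF l(2)] by (auto simp: o_def q_def p_def)
  have "q \<in> K (Suc (Suc j))" "p \<in> K (Suc j)"
    using l(1) by (auto simp: q_def p_def)
  \<comment> \<open>The limit \<open>q\<close> stays outside \<open>K (Suc j)\<close>, whereas
    \<open>p\<close> lies in it; this separates the two boundary points.\<close>
  have "q \<in> X - I (Suc (Suc j))"
    using \<sigma>(5) KX by (intro closed_sequentially[OF closedI _ q]) auto
  then have qK: "q \<notin> K (Suc j)"
    using KI by auto
  have start: "0 \<in> {0..T n}" and stop: "T n \<in> {0..T n}" for n
    using \<sigma>(1) by auto
  have "p \<in> X - I (Suc j)"
    using \<sigma>(4) stop by (intro closed_sequentially[OF closedI _ p]) blast
  then have pK: "p \<notin> K j"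
    using KI by auto
  have distinct: "inj (\<lambda>n. U (s n))" if "strict_mono s" for s :: "nat \<Rightarrow> nat"
    using inj_compose[OF U(1) strict_mono_imp_inj_on[OF that]] by (simp add: o_def)
  note limit = limit_of_distinct_components[OF \<Omega>(1) compact_imp_closed[OF compactK] U(2) distinct]
  have "q \<notin> \<Omega>"
    using limit[OF r _ q] \<sigma>(3) start qK KS by blast
  have "p \<notin> \<Omega>"
    using limit[OF r _ p] \<sigma>(3) stop pK by blast
  have "Pt q \<in> end_boundary \<Omega> K" "Pt p \<in> end_boundary \<Omega> K"
    using \<open>q \<notin> \<Omega>\<close> \<open>p \<notin> \<Omega>\<close> \<open>q \<in> X - _\<close> \<open>p \<in> X - _\<close>
    by (auto simp: end_boundary_def topspace_end_compactification X_def)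
  moreover have "Pt q \<noteq> Pt p"
    using qK \<open>p \<in> K (Suc j)\<close> by auto
  ultimately have "visible_pair \<Omega> K 1 \<kappa> (Pt q) (Pt p)"
    using vis by (auto simp: visibility_property_def)
  then obtain V W C where V: "Pt q \<in> end_compactification X K interior_of V"
    and W: "Pt p \<in> end_compactification X K interior_of W" and C: "compact C" "C \<subseteq> \<Omega>"
    and hit: "\<forall>T\<ge>0. \<forall>\<sigma>. almost_geodesic \<Omega> 1 \<kappa> {0..T} \<sigma> \<and> Pt (\<sigma> 0) \<in> V \<and> Pt (\<sigma> T) \<in> W \<longrightarrow>
      \<sigma> ` {0..T} \<inter> C \<noteq> {}"
    unfolding visible_pair_def Let_def X_def[symmetric] by (elim exE conjE) (rule that; assumption)
  have near: "\<forall>\<^sub>F n in sequentially. Pt (x n) \<in> N"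
    if "Pt c \<in> end_compactification X K interior_of N" "\<And>n. x n \<in> X" "x \<longlonglongrightarrow> c" for N c and x :: "nat \<Rightarrow> _"
  proof -
    have "open_in_ends X K (end_compactification X K interior_of N)"
      unfolding openin_end_compactification[symmetric] by (rule openin_interior_of)
    from eventually_Pt_in_open[OF this that] show ?thesis
      by (rule eventually_mono) (rule subsetD[OF interior_of_subset])
  qed
  have "\<forall>\<^sub>F n in sequentially. Pt (\<sigma> (r n) 0) \<in> V"
    using \<sigma>(5) KX by (intro near[OF V _ q]) blast
  moreover have "\<forall>\<^sub>F n in sequentially. Pt (\<sigma> (r n) (T (r n))) \<in> W"
    using \<sigma>(6) KX by (intro near[OF W _ p]) blast
  ultimately have "\<forall>\<^sub>F n in sequentially. \<sigma> (r n) ` {0..T (r n)} \<inter> C \<noteq> {}"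
    by eventually_elim (rule hit[rule_format], use \<sigma>(1,2) in auto)
  then obtain N where N: "\<And>n. \<sigma> (r (n + N)) ` {0..T (r (n + N))} \<inter> C \<noteq> {}"
    unfolding eventually_sequentially by (metis le_add2)
  then have "\<forall>n. \<exists>c. c \<in> \<sigma> (r (n + N)) ` {0..T (r (n + N))} \<inter> C"
    by blast
  then obtain c where c: "\<And>n. c n \<in> \<sigma> (r (n + N)) ` {0..T (r (n + N))}" "\<forall>n. c n \<in> C"
    by (metis IntD1 IntD2)
  obtain m s where s: "m \<in> C" "strict_mono s" "(c \<circ> s) \<longlonglongrightarrow> m"
    using C(1) c(2) unfolding compact_def by meson
  \<comment> \<open>All crossings avoid the relative interior \<open>I (Suc j)\<close>, which
    contains \<open>K j\<close>, so their accumulation point \<open>m\<close> cannot lie in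
    \<open>K j\<close>.\<close>
  have "m \<in> X - I (Suc j)"
    using c(1) \<sigma>(4) by (intro closed_sequentially[OF closedI _ s(3)]) (auto simp: o_def)
  then have "m \<in> \<Omega> - K j"
    using KI s(1) C(2) by auto
  moreover have "strict_mono (\<lambda>n. r (s n + N))"
    using r s(2) by (auto simp: strict_mono_def)
  then have "m \<notin> \<Omega> - K j"
    by (rule limit[OF _ _ s(3)]) (use c(1) \<sigma>(3) in \<open>auto simp: o_def\<close>)
  ultimately show False
    by blast
qed

text \<open>Components of \<open>closure \<Omega> - A\<close> need not be relatively open, so a point of the closure is
  attached to one of the finitely many components of \<open>\<Omega> - A\<close> by their closures.\<close>

lemma finite_components_closure:
  fixes \<Omega> :: "'a::real_normed_vector set"
  assumes "closed B" "A \<subseteq> B" and fin: "finite {U \<in> components (\<Omega> - A). U - B \<noteq> {}}" (is "finite ?F")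
  shows "finite {C \<in> components (closure \<Omega> - A). C - B \<noteq> {}}" (is "finite ?G")
proof (rule finite_subset)
  \<comment> \<open>Each component in \<open>?G\<close> contains some \<open>U\<close> in
    \<open>?F\<close> and is therefore recovered from any chosen point of \<open>U\<close>.\<close>
  show "?G \<subseteq> (\<lambda>U. connected_component_set (closure \<Omega> - A) (SOME u. u \<in> U)) ` ?F"
  proof
    fix C assume "C \<in> ?G"
    then obtain x where C: "C \<in> components (closure \<Omega> - A)" and x: "x \<in> C" "x \<notin> B"
      by blast
    have "\<Omega> - B \<subseteq> \<Union>(closure ` ?F)"
    proof
      fix y assume y: "y \<in> \<Omega> - B"
      then have "y \<in> \<Omega> - A" using assms(2) by auto
      then obtain U where "U \<in> components (\<Omega> - A)" "y \<in> U"
        by (metis UnionE Union_components)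
      with y show "y \<in> \<Union>(closure ` ?F)"
        using closure_subset[of U] by blast
    qed
    \<comment> \<open>The complement of \<open>B\<close> is an open neighbourhood of
      \<open>x\<close>, so points of \<open>\<Omega>\<close> near \<open>x\<close> can be taken
      outside \<open>B\<close>.\<close>
    moreover have "x \<in> closure (\<Omega> - B)"
      using x in_components_subset[OF C] open_Int_closure_subset[of "- B" \<Omega>] assms(1)
      by (auto simp: Diff_eq Int_commute)
    \<comment> \<open>Finiteness of \<open>?F\<close> makes the union of closures closed, so it
      contains \<open>x\<close> along with the closure of \<open>\<Omega> - B\<close>.\<close>
    moreover have "closed (\<Union>(closure ` ?F))"
      using fin by (intro closed_Union) auto
    ultimately have "x \<in> \<Union>(closure ` ?F)"
      using closure_minimal by blast
    then obtain U where U: "U \<in> ?F" "x \<in> closure U"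
      by blast
    \<comment> \<open>Adding a limit point keeps \<open>U\<close> connected, and this places
      \<open>U\<close> inside the component \<open>C\<close> of \<open>x\<close>.\<close>
    have "connected (insert x U)"
      by (rule connected_intermediate_closure[of U]) (use U closure_subset in_components_connected in auto)
    moreover have "insert x U \<subseteq> closure \<Omega> - A"
      using U(1) in_components_subset[of U] in_components_subset[OF C] x(1) closure_subset by blast
    ultimately have "insert x U \<subseteq> C"
      using x(1) by (intro components_maximal[OF C]) auto
    moreover have "U \<noteq> {}"
      using U(1) by blast
    then have "(SOME u. u \<in> U) \<in> U"
      by (simp add: some_in_eq)
    ultimately have "(SOME u. u \<in> U) \<in> C"
      by blast
    then have "C = connected_component_set (closure \<Omega> - A) (SOME u. u \<in> U)"
      using C unfolding components_iff by (metis connected_component_eq)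
    with U(1) show "C \<in> (\<lambda>U. connected_component_set (closure \<Omega> - A) (SOME u. u \<in> U)) ` ?F"
      by blast
  qed
qed (use fin in blast)

theorem theorem3p3:
  fixes \<Omega> :: "(complex ^ 'd) set" and K :: "nat \<Rightarrow> (complex ^ 'd) set"
  assumes "open \<Omega>" and "connected \<Omega>" and "\<not> bounded \<Omega>"
    and "kobayashi_hyperbolic \<Omega>"
    and "compact_exhaustion (closure \<Omega>) K"
    and "\<exists>\<kappa>>0. visibility_property \<Omega> K 1 \<kappa>"
  shows "sequentially_compact_space (end_compactification (closure \<Omega>) K)"
proof (rule sequentially_compact_end_compactification[OF assms(5)])
  fix j
  obtain \<kappa> where \<kappa>: "\<kappa> > 0" "visibility_property \<Omega> K 1 \<kappa>"
    using assms(6) by blast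
  \<comment> \<open>The shell argument uses two further levels of the exhaustion, hence the index
    \<open>Suc (Suc j)\<close>.\<close>
  have "finite {C \<in> components (closure \<Omega> - K j). C - K (Suc (Suc j)) \<noteq> {}}"
    using compact_exhaustionD(1)[OF assms(5)] compact_exhaustion_mono[OF assms(5), of j "Suc (Suc j)"]
      finite_components_meeting_far[OF assms(1,2,5) \<kappa>]
    by (intro finite_components_closure) (auto intro: compact_imp_closed)
  then show "\<exists>n\<ge>j. finite {C \<in> components (closure \<Omega> - K j). C - K n \<noteq> {}}"
    by (intro exI[of _ "Suc (Suc j)"]) auto
qed

end
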